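(* Let $n>d$, let $\mathcal{F}=\{f_i\}_{i=1}^n\in\mathbf{F}(n,d)$, $\lambda=\lambda(S_{\mathcal{F}}^{-1})$, $m=2d-n$ and $t\ge\operatorname{tr}\lambda$. Let $\nu=\nu(\lambda,m,t)\in\mathbb{R}^d$ be the vector defined in the context. Then $\nu\in\Lambda_t(\mathcal{D}(\mathcal{F}))$ and: \begin{enumerate} \item If $\mathcal{G}_t\in\mathcal{D}_t(\mathcal{F})$ is such that $\lambda(S_{\mathcal{G}_t})=\nu$, then $$\sum_{i=1}^df(\nu_i)=P_f(\mathcal{G}_t)\le P_f(\mathcal{G})\quad\text{for every }\mathcal{G}\in\mathcal{D}_t(\mathcal{F})$$ and every increasing convex function $f:[0,\infty)\to[0,\infty)$. \item If we assume further that $f$ is strictly convex, then every global minimizer $\mathcal{G}_t'$ of $P_f$ on $\mathcal{D}_t(\mathcal{F})$ satisfies $\lambda(S_{\mathcal{G}_t'})=\nu$. \end{enumerate}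
   Context: $\mathcal{H}\cong\mathbb{C}^d$. For $\mathcal{F}=\{f_i\}_{i=1}^n\in\mathcal{H}^n$ the analysis operator is $T_{\mathcal{F}}:\mathcal{H}\to\mathbb{C}^n$, $T_{\mathcal{F}}x=(\langle x,f_i\rangle)_i$, and the frame operator is $S_{\mathcal{F}}=T_{\mathcal{F}}^*T_{\mathcal{F}}$. $\mathbf{F}(n,d)$ is the set of $(n,d)$-frames, i.e. sequences of $n$ vectors spanning $\mathcal{H}$ (so $S_{\mathcal{F}}$ is invertible). The set of dual frames is $\mathcal{D}(\mathcal{F})=\{\mathcal{G}\in\mathbf{F}(n,d):T_{\mathcal{G}}^*T_{\mathcal{F}}=I\}$; $\mathcal{D}_t(\mathcal{F})=\{\mathcal{G}\in\mathcal{D}(\mathcal{F}):\operatorname{tr}S_{\mathcal{G}}\ge t\}$ and $\Lambda_t(\mathcal{D}(\mathcal{F}))=\{\lambda(S_{\mathcal{G}}):\mathcal{G}\in\mathcal{D}_t(\mathcal{F})\}$, where $\lambda(S)$ is the vector of eigenvalues of $S$ counted with multiplicity in decreasing order. For convex $f:[0,\infty)\to[0,\infty)$, $P_f(\mathcal{G})=\operatorname{tr}(f(S_{\mathcal{G}}))$. Let $\lambda\in\mathbb{R}^d$ have nonnegative decreasing entries, $t_0=\operatorname{tr}\lambda=\sum_i\lambda_i$. For $t\ge t_0$ and $q\in\{0,\dots,d-1\}$ let $p_\lambda(q,t)=\frac{t-\sum_{j=1}^q\lambda_j}{d-q}$, and $$r_\lambda(t)=\min\{q\in\{0,\dots,d-1\}:p_\lambda(q,t)\ge\lambda_{q+1}\},\qquad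 c_\lambda(t)=p_\lambda(r_\lambda(t),t).$$ For $1\le m\le d-1$ let $s^*=\sum_{i=1}^m\lambda_i+(d-m)\lambda_m$, $s^{**}=(d-m)\lambda_1+\sum_{j=1}^m\lambda_j$, and for $t\ge t_0$ $$c_{\lambda,m}(t)=\begin{cases}c_\lambda(t)& t\le s^*\\ \lambda_m+\frac{t-s^*}{d-m}& t>s^*\end{cases},\qquad r_{\lambda,m}(t)=\min\{q\in\{0,\dots,d-1\}:c_{\lambda,m}(t)\ge\lambda_{q+1}\}.$$ For $m\le0$ set $c_{\lambda,m}=c_\lambda$ and $r_{\lambda,m}=r_\lambda$. With $c=c_{\lambda,m}(t)$, $r=r_{\lambda,m}(t)$ and $\mathbf{1}_q$ the all-ones vector of length $q$, for an integer $m<d$ the vector $\nu=\nu(\lambda,m,t)$ is: $(\lambda_1,\dots,\lambda_r,c\,\mathbf{1}_{d-r})$ if $m\le0$, or if $m\ge1$ and $t\le s^*$; $(\lambda_1,\dots,\lambda_r,c\,\mathbf{1}_{d-m},\lambda_{r+1},\dots,\lambda_m)$ if $m\ge1$ and $s^*<t<s^{**}$; $(c\,\mathbf{1}_{d-m},\lambda_1,\dots,\lambda_m)$ if $m\ge1$ and $t\ge s^{**}$. *)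

theory Defs
  imports
    "HOL-Analysis.Convex"
    "Jordan_Normal_Form.Schur_Decomposition"
    "Jordan_Normal_Form.Gauss_Jordan_Elimination"
begin

text \<open>Eigenvalues with multiplicity in decreasing order. The list exists and is unique
  precisely when all roots of the characteristic polynomial are real; it is used for Hermitian
  matrices only.\<close>

definition eigs :: "complex mat \<Rightarrow> real list" where
  "eigs A = (THE es. sorted_wrt (\<ge>) es \<and>
     char_poly A = (\<Prod>a\<leftarrow>es. [:- complex_of_real a, 1:]))"

definition mat_tr :: "complex mat \<Rightarrow> complex" where
  "mat_tr A = sum_list (diag_mat A)"

text \<open>The value of \<open>f\<close> at a Hermitian matrix: diagonalise by a unitary matrix and apply \<open>f\<close> to
  the eigenvalues. The result does not depend on the choice of the diagonalisation, so the
  description is definite.\<close>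

definition mat_fun :: "(real \<Rightarrow> real) \<Rightarrow> complex mat \<Rightarrow> complex mat" where
  "mat_fun f A = (let k = dim_row A in
     THE B. \<exists>U \<mu>. U \<in> carrier_mat k k \<and> mat_adjoint U * U = 1\<^sub>m k \<and>
       A = U * mat_diag k (\<lambda>i. complex_of_real (\<mu> i)) * mat_adjoint U \<and>
       B = U * mat_diag k (\<lambda>i. complex_of_real (f (\<mu> i))) * mat_adjoint U)"

definition strictly_convex_on :: "real set \<Rightarrow> (real \<Rightarrow> real) \<Rightarrow> bool" where
  "strictly_convex_on A f \<longleftrightarrow> convex A \<and>
     (\<forall>x\<in>A. \<forall>y\<in>A. \<forall>u. x \<noteq> y \<longrightarrow> 0 < u \<longrightarrow> u < 1 \<longrightarrow>
        f ((1 - u) * x + u * y) < (1 - u) * f x + u * f y)"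

definition frames :: "nat \<Rightarrow> nat \<Rightarrow> complex vec list set" where
  "frames n d = {F. length F = n \<and> set F \<subseteq> carrier_vec d \<and>
     LinearCombinations.module.span class_ring (module_vec TYPE(complex) d) (set F)
       = carrier_vec d}"

text \<open>The inner product is linear in its first argument, so the rows of the matrix of the
  analysis operator are the conjugates of the frame vectors.\<close>

definition analysis_op :: "nat \<Rightarrow> complex vec list \<Rightarrow> complex mat" where
  "analysis_op d F = mat_of_rows d (map conjugate F)"

lemma analysis_op_mult_vec:
  assumes "set F \<subseteq> carrier_vec d" and "x \<in> carrier_vec d"
  shows "analysis_op d F *\<^sub>v x = vec (length F) (\<lambda>i. x \<bullet>c (F ! i))"
proof (rule eq_vecI)
  fix i assume "i < dim_vec (vec (length F) (\<lambda>i. x \<bullet>c (F ! i)))"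
  then have i: "i < length F" by simp
  then have c: "conjugate (F ! i) \<in> carrier_vec d" using assms(1) by (auto dest: nth_mem)
  have "row (analysis_op d F) i = conjugate (F ! i)"
    using i c unfolding analysis_op_def by (subst mat_of_rows_row) auto
  then show "(analysis_op d F *\<^sub>v x) $ i = vec (length F) (\<lambda>i. x \<bullet>c (F ! i)) $ i"
    using i c assms(2) by (auto simp: analysis_op_def comm_scalar_prod[OF c assms(2)])
qed (simp add: analysis_op_def)

definition frame_op :: "nat \<Rightarrow> complex vec list \<Rightarrow> complex mat" where
  "frame_op d F = mat_adjoint (analysis_op d F) * analysis_op d F"

definition dual_frames :: "nat \<Rightarrow> nat \<Rightarrow> complex vec list \<Rightarrow> complex vec list set" where
  "dual_frames n d F =
     {G \<in> frames n d. mat_adjoint (analysis_op d G) * analysis_op d F = 1\<^sub>m d}"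

definition dual_frames_ge ::
    "nat \<Rightarrow> nat \<Rightarrow> complex vec list \<Rightarrow> real \<Rightarrow> complex vec list set" where
  "dual_frames_ge n d F t = {G \<in> dual_frames n d F. Re (mat_tr (frame_op d G)) \<ge> t}"

definition dual_spectra ::
    "nat \<Rightarrow> nat \<Rightarrow> complex vec list \<Rightarrow> real \<Rightarrow> real list set" where
  "dual_spectra n d F t = (\<lambda>G. eigs (frame_op d G)) ` dual_frames_ge n d F t"

text \<open>The trace of \<open>f(S)\<close> is real since \<open>f(S)\<close> is Hermitian.\<close>

definition convex_potential :: "nat \<Rightarrow> (real \<Rightarrow> real) \<Rightarrow> complex vec list \<Rightarrow> real" where
  "convex_potential d f G = Re (mat_tr (mat_fun f (frame_op d G)))"

text \<open>A vector \<open>\<lambda> \<in> \<real>\<^sup>d\<close> is a list \<open>l\<close> of length \<open>d\<close>. Lists are indexed from \<open>0\<close>, so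
  \<open>\<lambda>\<^sub>j\<close> is \<open>l ! (j - 1)\<close> and \<open>(\<lambda>\<^sub>1, \<dots>, \<lambda>\<^sub>q)\<close> is \<open>take q l\<close>.\<close>

definition p_lam :: "real list \<Rightarrow> nat \<Rightarrow> real \<Rightarrow> real" where
  "p_lam l q t = (t - sum_list (take q l)) / (real (length l) - real q)"

definition r_lam :: "real list \<Rightarrow> real \<Rightarrow> nat" where
  "r_lam l t = Min {q \<in> {0..<length l}. p_lam l q t \<ge> l ! q}"

definition c_lam :: "real list \<Rightarrow> real \<Rightarrow> real" where
  "c_lam l t = p_lam l (r_lam l t) t"

definition s_star :: "real list \<Rightarrow> nat \<Rightarrow> real" where
  "s_star l m = sum_list (take m l) + (real (length l) - real m) * l ! (m - 1)"

definition s_star_star :: "real list \<Rightarrow> nat \<Rightarrow> real" where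
  "s_star_star l m = (real (length l) - real m) * l ! 0 + sum_list (take m l)"

definition c_lam_m :: "real list \<Rightarrow> int \<Rightarrow> real \<Rightarrow> real" where
  "c_lam_m l m t =
     (if m \<le> 0 then c_lam l t
      else let k = nat m in
        if t \<le> s_star l k then c_lam l t
        else l ! (k - 1) + (t - s_star l k) / (real (length l) - real k))"

definition r_lam_m :: "real list \<Rightarrow> int \<Rightarrow> real \<Rightarrow> nat" where
  "r_lam_m l m t =
     (if m \<le> 0 then r_lam l t
      else Min {q \<in> {0..<length l}. c_lam_m l m t \<ge> l ! q})"

definition nu_vec :: "real list \<Rightarrow> int \<Rightarrow> real \<Rightarrow> real list" where
  "nu_vec l m t =
     (let d = length l; c = c_lam_m l m t; r = r_lam_m l m t; k = nat m in
      if m \<le> 0 \<or> t \<le> s_star l k then take r l @ replicate (d - r) c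
      else if t < s_star_star l k
        then take r l @ replicate (d - k) c @ drop r (take k l)
      else replicate (d - k) c @ take k l)"

end

theory Submission
  imports Defs "Jordan_Normal_Form.Spectral_Radius"
begin

unbundle no inner_syntax

text \<open>Write \<open>l\<close> for the spectrum of \<open>S\<^sub>F\<inverse>\<close>. The frame operators of the dual frames of \<open>F\<close> are
  the matrices \<open>S\<^sub>F\<inverse> + V V\<^sup>*\<close> with \<open>V\<close> of size \<open>d \<times> (n - d)\<close>, so their spectra \<open>\<mu>\<close> satisfy
  \<open>\<mu>\<^sub>i \<ge> l\<^sub>i\<close>, and \<open>\<mu>\<^sub>i \<le> l\<^sub>j\<close> for \<open>j = i - (n - d)\<close>. Up to order, \<open>\<nu>\<close> is obtained from \<open>l\<close> by raising
  the last \<open>d - max m 0\<close> entries to at least \<open>c\<close>, which a diagonal perturbation achieves. The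
  spectral inequalities put every \<open>\<nu>\<^sub>i\<close> between \<open>c\<close> and \<open>\<mu>\<^sub>i\<close>. Hence, if \<open>s \<ge> 0\<close> is a subgradient
  of \<open>f\<close> at the single point \<open>c\<close>, then \<open>f \<mu>\<^sub>i - f \<nu>\<^sub>i \<ge> s (\<mu>\<^sub>i - \<nu>\<^sub>i)\<close> for all \<open>i\<close>, and summation
  gives optimality without any majorization argument.\<close>

section \<open>Convex sums and the optimal vector\<close>

text \<open>The shape of \<open>nu_vec\<close> comes from a shortage of columns. A diagonal
  perturbation with n - d columns raises at most n - d entries of l; for m > 0 this is d - m < d, so
  m entries keep their values. Up to \<open>s_star\<close> this costs nothing: the level c that
  brings the trace to t is at most the m-th entry, and every entry to be raised lies among the last
  d - m anyway. Beyond \<open>s_star\<close> the level overtakes some of the fixed entries, which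
  after sorting sit below the block of c's, d - m = n - d places further down. That is the index
  shift in the upper bound on \<mu>, so the two spectral bounds close up on \<nu>. At
  \<open>s_star_star\<close> the level reaches the largest entry. The sign of the slope s is what
  lets the constraint be tr >= t and not an equality. A second obstacle is that \<open>eigs\<close>
  and \<open>mat_fun\<close> are definite descriptions: nothing can be computed with them before the
  spectral theorem, the uniqueness of the sorted spectrum and the independence of f(S) from the
  diagonalisation are established.\<close>

text \<open>For c > 0 the left derivative, the supremum of the difference quotients from the left,
  is a subgradient; comparing the values at 0 and c makes it nonnegative. At c = 0 there are no such
  quotients, and s = 0 works because f is increasing.\<close>

lemma mono_convex_subgradient:
  fixes f :: "real \<Rightarrow> real"
  assumes "mono_on {0..} f" "convex_on {0..} f" "0 \<le> c"
  obtains s where "0 \<le> s" "\<And>y. 0 \<le> y \<Longrightarrow> f c + s * (y - c) \<le> f y"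
proof (cases "c = 0")
  case True
  have "f c + 0 * (y - c) \<le> f y" if "0 \<le> y" for y
    using assms(1) that True by (auto simp: mono_on_def)
  then show ?thesis using that[of 0] by simp
next
  case False
  define L where "L = (\<lambda>x. (f c - f x) / (c - x)) ` {0..<c}"
  define s where "s = Sup L"
  have slope: "(f c - f x) / (c - x) \<le> (f y - f c) / (y - c)" if "0 \<le> x" "x < c" "c < y" for x y
  proof -
    define u where "u = (c - x) / (y - x)"
    have u: "0 \<le> u" "u \<le> 1" using that by (auto simp: u_def)
    have uyx: "u * (y - x) = c - x" using that by (simp add: u_def)
    then have cu: "(1 - u) * x + u * y = c" by (simp add: algebra_simps)
    have "(y - x) * f c \<le> (y - x) * ((1 - u) * f x + u * f y)"
      using convex_onD[OF assms(2) u, of x y] that by (intro mult_left_mono) (simp_all add: cu)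
    also have "\<dots> = (y - x) * f x + (u * (y - x)) * (f y - f x)" by (simp add: algebra_simps)
    finally have "(f c - f x) * (y - c) \<le> (f y - f c) * (c - x)"
      unfolding uyx by (simp add: algebra_simps)
    then have "f c - f x \<le> (f y - f c) * (c - x) / (y - c)" using that by (simp add: pos_le_divide_eq)
    then show ?thesis using that by (simp add: pos_divide_le_eq)
  qed
  have ne: "L \<noteq> {}" using False assms(3) by (auto simp: L_def)
  have bdd: "bdd_above L" using slope[of _ "c + 1"] by (intro bdd_aboveI) (auto simp: L_def)
  have s: "f c + s * (y - c) \<le> f y" if y: "0 \<le> y" for y
  proof (rule linorder_cases[of y c])
    assume "y < c"
    then have "(f c - f y) / (c - y) \<le> s"
      unfolding s_def using y by (intro cSup_upper bdd) (auto simp: L_def)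
    then show ?thesis using \<open>y < c\<close> by (simp add: divide_le_eq algebra_simps)
  next
    assume "c < y"
    then have "s \<le> (f y - f c) / (y - c)"
      unfolding s_def using slope by (intro cSup_least ne) (auto simp: L_def)
    then show ?thesis using \<open>c < y\<close> by (simp add: pos_le_divide_eq algebra_simps)
  qed simp
  have "f 0 \<le> f c" using assms(1,3) by (auto simp: mono_on_def)
  then have "0 \<le> s * c" using s[of 0] by simp
  then have "0 \<le> s" using False assms(3) by (simp add: zero_le_mult_iff)
  then show ?thesis using s that by blast
qed

text \<open>The slope s belongs to the point c and not to x. It still serves at x because x lies
  between c and y: writing x = (1 - u) c + u y, convexity gives f y - f x >= (1 - u) (f y - f c),
  and the tangent bound at y is scaled by the same factor, since y - x = (1 - u) (y - c).\<close>

lemma convex_chord_ge_tangent: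
  fixes f :: "real \<Rightarrow> real"
  assumes f: "convex_on {0..} f" and c: "0 \<le> c" and y: "0 \<le> y" and x: "(c \<le> x \<and> x \<le> y) \<or> (y \<le> x \<and> x \<le> c)"
    and s: "\<And>z. 0 \<le> z \<Longrightarrow> f c + s * (z - c) \<le> f z"
  shows "s * (y - x) \<le> f y - f x"
    and "strictly_convex_on {0..} f \<Longrightarrow> x \<noteq> y \<Longrightarrow> s * (y - x) < f y - f x"
proof -
  obtain u where u: "0 \<le> u" "u \<le> 1" and xu: "x = (1 - u) * c + u * y"
  proof (cases "y = c")
    case True
    then show ?thesis using x that[of 0] by auto
  next
    case False
    define u where "u = (x - c) / (y - c)"
    have "0 \<le> u" "u \<le> 1" using x by (auto simp: u_def zero_le_divide_iff divide_le_eq_1)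
    moreover have "x - c = u * (y - c)" using False by (simp add: u_def)
    ultimately show ?thesis using that[of u] by (simp add: algebra_simps)
  qed
  have fx: "f x \<le> (1 - u) * f c + u * f y"
    using convex_onD[OF f u] c y xu by auto
  have yx: "y - x = (1 - u) * (y - c)" by (simp add: xu algebra_simps)
  have fyx: "(1 - u) * (f y - f c) \<le> f y - f x" using fx by (simp add: algebra_simps)
  have "(1 - u) * (s * (y - c)) \<le> (1 - u) * (f y - f c)"
    using u s[OF y] by (intro mult_left_mono) auto
  then show "s * (y - x) \<le> f y - f x" using fyx by (simp add: yx algebra_simps)
  assume sc: "strictly_convex_on {0..} f" and ne: "x \<noteq> y"
  then have yc: "y \<noteq> c" and u1: "u < 1" using u(2) xu by (auto simp: algebra_simps less_le)
  \<comment> \<open>The tangent bound at the midpoint of c and y, combined with strict convexity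
    there, makes the tangent bound at y strict.\<close>
  have "f ((1 - 1 / 2) * c + 1 / 2 * y) < (1 - 1 / 2) * f c + 1 / 2 * f y"
  proof -
    have "f ((1 - u) * x + u * z) < (1 - u) * f x + u * f z"
      if "x \<in> {0..}" "z \<in> {0..}" "x \<noteq> z" "0 < u" "u < 1" for x z u
      using sc that unfolding strictly_convex_on_def by blast
    from this[of c y "1 / 2"] show ?thesis using c y yc by simp
  qed
  then have "s * (y - c) < f y - f c"
    using s[of "(1 - 1 / 2) * c + 1 / 2 * y"] c y by (simp add: field_simps)
  then have "(1 - u) * (s * (y - c)) < (1 - u) * (f y - f c)"
    using u1 by (intro mult_strict_left_mono) auto
  then show "s * (y - x) < f y - f x" using fyx by (simp add: yx algebra_simps)
qed

text \<open>A single slope s is used for every index, so only the two totals enter, and s >= 0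
  absorbs an excess in the total of \<mu>. Equality of the sums of f leaves no room for a strict
  summand, which is how strict convexity pins down \<mu>.\<close>

lemma sum_convex_le:
  fixes f :: "real \<Rightarrow> real" and \<nu> \<mu> :: "nat \<Rightarrow> real"
  assumes f: "mono_on {0..} f" "convex_on {0..} f" and c: "0 \<le> c"
    and seg: "\<And>i. i < d \<Longrightarrow> (c \<le> \<nu> i \<and> \<nu> i \<le> \<mu> i) \<or> (\<mu> i \<le> \<nu> i \<and> \<nu> i \<le> c)"
    and nonneg: "\<And>i. i < d \<Longrightarrow> 0 \<le> \<mu> i"
    and sum: "(\<Sum>i<d. \<nu> i) \<le> (\<Sum>i<d. \<mu> i)"
  shows "(\<Sum>i<d. f (\<nu> i)) \<le> (\<Sum>i<d. f (\<mu> i))"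
    and "strictly_convex_on {0..} f \<Longrightarrow> (\<Sum>i<d. f (\<mu> i)) \<le> (\<Sum>i<d. f (\<nu> i)) \<Longrightarrow> i < d \<Longrightarrow> \<mu> i = \<nu> i"
proof -
  obtain s where s: "0 \<le> s" "\<And>y. 0 \<le> y \<Longrightarrow> f c + s * (y - c) \<le> f y"
    using mono_convex_subgradient[OF f c] by blast
  have le: "s * (\<mu> i - \<nu> i) \<le> f (\<mu> i) - f (\<nu> i)" if "i < d" for i
    using convex_chord_ge_tangent(1)[OF f(2) c nonneg[OF that] seg[OF that] s(2)] .
  have "0 \<le> s * ((\<Sum>i<d. \<mu> i) - (\<Sum>i<d. \<nu> i))" using s(1) sum by simp
  also have "\<dots> = (\<Sum>i<d. s * (\<mu> i - \<nu> i))" by (simp add: sum_subtractf sum_distrib_left[symmetric])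
  finally have ge0: "0 \<le> (\<Sum>i<d. s * (\<mu> i - \<nu> i))" .
  also have "\<dots> \<le> (\<Sum>i<d. f (\<mu> i) - f (\<nu> i))" using le by (intro sum_mono) auto
  finally show "(\<Sum>i<d. f (\<nu> i)) \<le> (\<Sum>i<d. f (\<mu> i))" by (simp add: sum_subtractf)
  assume sc: "strictly_convex_on {0..} f" and fle: "(\<Sum>i<d. f (\<mu> i)) \<le> (\<Sum>i<d. f (\<nu> i))" and i: "i < d"
  show "\<mu> i = \<nu> i"
  proof (rule ccontr)
    assume "\<mu> i \<noteq> \<nu> i"
    then have "s * (\<mu> i - \<nu> i) < f (\<mu> i) - f (\<nu> i)"
      using convex_chord_ge_tangent(2)[OF f(2) c nonneg[OF i] seg[OF i] s(2) sc] by metis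
    then have "(\<Sum>i<d. s * (\<mu> i - \<nu> i)) < (\<Sum>i<d. f (\<mu> i) - f (\<nu> i))"
      using le i by (intro sum_strict_mono_ex1) auto
    then show False using ge0 fle by (simp add: sum_subtractf)
  qed
qed

section \<open>The level c and the vector \<nu>\<close>

lemma sum_list_take_ge:
  fixes l :: "real list"
  assumes "r \<le> k" "k \<le> length l" "\<And>i. r \<le> i \<Longrightarrow> i < k \<Longrightarrow> l ! i \<le> c"
  shows "sum_list (take k l) \<le> sum_list (take r l) + (real k - real r) * c"
  using assms
proof (induction k rule: dec_induct)
  case (step k)
  then have "l ! k \<le> c" "sum_list (take k l) \<le> sum_list (take r l) + (real k - real r) * c" by auto
  then show ?case using step.prems by (simp add: take_Suc_conv_app_nth algebra_simps)
qed simp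

lemma sorted_desc_nth:
  fixes l :: "real list"
  assumes "sorted_wrt (\<ge>) l" "i \<le> j" "j < length l"
  shows "l ! j \<le> l ! i"
  using assms sorted_wrt_nth_less[of "(\<ge>)" l i j] by (cases "i = j") auto

text \<open>The minimum is over a nonempty set because q = d - 1 always qualifies, thanks to
  \<open>sum_list l \<le> t\<close>. For q = r - 1 the value \<open>p_lam l q t\<close> is the
  weighted average of \<open>l ! q\<close> and c with weights 1 and d - r; minimality puts it below
  \<open>l ! q\<close>, hence c is below \<open>l ! q\<close> as well.\<close>

lemma r_lam_props:
  fixes l :: "real list"
  assumes sorted: "sorted_wrt (\<ge>) l" and "0 < length l" and t: "sum_list l \<le> t"
  defines "r \<equiv> r_lam l t" and "c \<equiv> c_lam l t"
  shows "r < length l" "l ! r \<le> c" "\<And>i. i < r \<Longrightarrow> c < l ! i"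
    "sum_list (take r l) + (real (length l) - real r) * c = t"
proof -
  define d where "d = length l"
  define Q where "Q = {q \<in> {0..<d}. l ! q \<le> p_lam l q t}"
  have d: "0 < d" using assms by (simp add: d_def)
  have p: "(real d - real q) * p_lam l q t = t - sum_list (take q l)" if "q < d" for q
    using that by (simp add: p_lam_def d_def)
  have "take (Suc (d - 1)) l = take (d - 1) l @ [l ! (d - 1)]"
    using d by (intro take_Suc_conv_app_nth) (simp add: d_def)
  then have "sum_list (take (Suc (d - 1)) l) = sum_list (take (d - 1) l) + l ! (d - 1)"
    by (metis sum_list.Cons sum_list.Nil sum_list_append add.right_neutral)
  then have "sum_list l = sum_list (take (d - 1) l) + l ! (d - 1)"
    using d by (simp add: d_def)
  then have "d - 1 \<in> Q" using p[of "d - 1"] d t by (simp add: Q_def of_nat_diff)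
  then have rQ: "r \<in> Q" unfolding r_def r_lam_def Q_def d_def[symmetric] by (intro Min_in) auto
  have rmin: "r \<le> q" if "q \<in> Q" for q
    using that unfolding r_def r_lam_def Q_def d_def[symmetric] by (intro Min_le) auto
  have c: "c = p_lam l r t" by (simp add: c_def c_lam_def r_def)
  show rd: "r < length l" and "l ! r \<le> c" using rQ by (auto simp: Q_def d_def c)
  show "sum_list (take r l) + (real (length l) - real r) * c = t"
    using p[of r] rd by (simp add: c d_def)
  fix i assume i: "i < r"
  define q where "q = r - 1"
  have q: "q < r" "r = Suc q" "q < d" using i rd by (auto simp: q_def d_def)
  then have "q \<notin> Q" using rmin[of q] by auto
  then have pq: "p_lam l q t < l ! q" using q by (auto simp: Q_def)
  have "sum_list (take r l) = sum_list (take q l) + l ! q"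
    using q by (simp add: take_Suc_conv_app_nth d_def)
  then have "(real d - real r) * c = (real d - real q) * p_lam l q t - l ! q"
    using p[of q] p[of r] q rd by (simp add: c d_def)
  also have "\<dots> < (real d - real q) * l ! q - l ! q"
    using pq q by (intro diff_strict_right_mono mult_strict_left_mono) auto
  also have "\<dots> = (real d - real r) * l ! q" by (simp add: q algebra_simps)
  finally have "c < l ! q" using rd by (simp add: d_def mult_less_cancel_left_pos)
  then show "c < l ! i" using sorted_desc_nth[OF sorted, of i q] i q by (simp add: d_def)
qed

text \<open>This is the interface to \<nu>: the formula for c stays hidden. The multiset clause is
  what the construction of a dual frame needs, and the last clause supplies the hypothesis
  \<open>seg\<close> of \<open>sum_convex_le\<close> for any \<mu> that obeys the two spectral
  bounds.\<close>

lemma nu_vec_props: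
  fixes l :: "real list" and m :: int and t :: real
  assumes sorted: "sorted_wrt (\<ge>) l" and d: "d = length l" and md: "m < int d" and d0: "0 < d"
    and nonneg: "\<And>x. x \<in> set l \<Longrightarrow> 0 \<le> x" and t: "sum_list l \<le> t" and k: "k = nat m"
  obtains c where "0 \<le> c" "length (nu_vec l m t) = d" "sorted_wrt (\<ge>) (nu_vec l m t)"
    "sum_list (nu_vec l m t) = t"
    "mset (nu_vec l m t) = mset (take k l @ map (max c) (drop k l))"
    "\<And>\<mu> i. (\<And>j. j < d \<Longrightarrow> l ! j \<le> \<mu> j) \<Longrightarrow> (\<And>j. d - k \<le> j \<Longrightarrow> j < d \<Longrightarrow> \<mu> j \<le> l ! (j - (d - k)))
      \<Longrightarrow> i < d \<Longrightarrow> (c \<le> nu_vec l m t ! i \<and> nu_vec l m t ! i \<le> \<mu> i) \<or> (\<mu> i \<le> nu_vec l m t ! i \<and> nu_vec l m t ! i \<le> c)"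
proof -
  define c where "c = c_lam_m l m t"
  define r where "r = r_lam_m l m t"
  have kd: "k < d" using md d0 k by auto
  have nth_nonneg: "0 \<le> l ! i" if "i < d" for i using nonneg that d by simp
  show thesis
  proof (cases "m \<le> 0 \<or> t \<le> s_star l k")
    case True
    define r' where "r' = r_lam l t"
    have c: "c = c_lam l t" using True by (auto simp: c_def c_lam_m_def k)
    have R: "r' < d" "l ! r' \<le> c" "\<And>i. i < r' \<Longrightarrow> c < l ! i"
      "sum_list (take r' l) + (real d - real r') * c = t"
      using r_lam_props[OF sorted _ t] d0 by (auto simp: c r'_def d)
    have ge_r: "l ! i \<le> c" if "r' \<le> i" "i < d" for i
      using sorted_desc_nth[OF sorted that(1)] that R(2) d by force
    \<comment> \<open>For m > 0, \<open>r_lam_m\<close> compares the entries with one fixed level,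
      whereas in \<open>r_lam\<close> the level \<open>p_lam l q t\<close> varies with q. Both
      minima are the first index whose entry is at most c.\<close>
    have r: "r = r'"
    proof (cases "m \<le> 0")
      case False
      have "Min {q \<in> {0..<d}. l ! q \<le> c} = r'"
      proof (rule Min_eqI)
        fix q assume "q \<in> {q \<in> {0..<d}. l ! q \<le> c}"
        then show "r' \<le> q" using R(3)[of q] by force
      qed (use R(1,2) in auto)
      then show ?thesis using False by (simp add: r_def r_lam_m_def d c_def)
    qed (simp add: r_def r_lam_m_def r'_def)
    have nu: "nu_vec l m t = take r' l @ replicate (d - r') c"
      using True by (simp add: nu_vec_def Let_def k c_def[symmetric] r_def[symmetric] r d)
    \<comment> \<open>This is the meaning of t <= \<open>s_star\<close>: the first k entries already
      reach the level. If c exceeded \<open>l ! (k - 1)\<close>, filling up to c would take a trace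
      larger than \<open>s_star\<close>.\<close>
    have c_le: "c \<le> l ! i" if "i < k" for i
    proof -
      have k1: "0 < m" "k - 1 < d" using that k kd by auto
      then have ts: "t \<le> sum_list (take k l) + (real d - real k) * l ! (k - 1)"
        using True by (auto simp: s_star_def d)
      have "c \<le> l ! (k - 1)"
      proof (rule ccontr)
        assume *: "\<not> c \<le> l ! (k - 1)"
        then have "r' \<le> k - 1" using R(3)[of "k - 1"] by force
        then have "sum_list (take k l) \<le> sum_list (take r' l) + (real k - real r') * c"
          using ge_r kd d by (intro sum_list_take_ge) auto
        moreover have "(real d - real k) * l ! (k - 1) < (real d - real k) * c"
          using * kd by (intro mult_strict_left_mono) auto
        ultimately show False using ts R(4) by (simp add: algebra_simps)
      qed
      then show ?thesis using sorted_desc_nth[OF sorted, of i "k - 1"] that kd d by force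
    qed
    \<comment> \<open>In this regime \<nu> is l cut off from below at c, in the original order, so
      the segment condition follows from the lower bound on \<mu> alone.\<close>
    have nth: "nu_vec l m t ! i = max c (l ! i)" if "i < d" for i
      using that R(1) R(3)[of i] ge_r[of i] d by (auto simp: nu nth_append max_def)
    have len: "length (nu_vec l m t) = d" using R(1) d by (simp add: nu)
    have kap: "nu_vec l m t = take k l @ map (max c) (drop k l)"
    proof (rule nth_equalityI)
      fix i assume "i < length (nu_vec l m t)"
      then have i: "i < d" using len by simp
      then show "nu_vec l m t ! i = (take k l @ map (max c) (drop k l)) ! i"
        using nth[OF i] c_le[of i] kd d by (auto simp: nth_append)
    qed (use len kd d in auto)
    show thesis
    proof (rule that[of c])
      show "0 \<le> c" using R(1,2) nth_nonneg[of r'] by simp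
      show "sorted_wrt (\<ge>) (nu_vec l m t)"
        unfolding sorted_wrt_iff_nth_less len
      proof (intro allI impI)
        fix i j assume "i < j" "j < d"
        then show "nu_vec l m t ! j \<le> nu_vec l m t ! i"
          using nth[of i] nth[of j] sorted_desc_nth[OF sorted, of i j] d max.mono[OF order_refl[of c]] by simp
      qed
      show "sum_list (nu_vec l m t) = t"
        using R(1,4) by (simp add: nu sum_list_replicate of_nat_diff)
      show "mset (nu_vec l m t) = mset (take k l @ map (max c) (drop k l))" using kap by simp
      show "(c \<le> nu_vec l m t ! i \<and> nu_vec l m t ! i \<le> \<mu> i) \<or> (\<mu> i \<le> nu_vec l m t ! i \<and> nu_vec l m t ! i \<le> c)"
        if "\<And>j. j < d \<Longrightarrow> l ! j \<le> \<mu> j" "i < d" for \<mu> i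
        using nth[OF that(2)] that(1)[OF that(2)] by (auto simp: max_def)
    qed (rule len)
  next
    case False
    then have m: "0 < m" and ts: "s_star l k < t" by auto
    then have k0: "0 < k" by (simp add: k)
    have c: "c = l ! (k - 1) + (t - s_star l k) / (real d - real k)"
      using False by (auto simp: c_def c_lam_m_def k d Let_def)
    \<comment> \<open>Once \<open>s_star\<close> is eliminated, the formula for c says that the
      whole excess over the first k entries is spread evenly over d - k positions.\<close>
    have cd: "(real d - real k) * c = t - sum_list (take k l)"
      using kd by (simp add: c s_star_def d field_simps)
    have ck: "l ! (k - 1) < c" using ts kd by (simp add: c)
    have r: "r = Min {q \<in> {0..<d}. l ! q \<le> c}" using m by (simp add: r_def r_lam_m_def d c_def)
    have "r \<in> {q \<in> {0..<d}. l ! q \<le> c}"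
      unfolding r by (rule Min_in) (use ck kd in \<open>auto intro!: exI[of _ "k - 1"]\<close>)
    then have R: "r < d" "l ! r \<le> c" by auto
    have R3: "c < l ! i" if "i < r" for i
    proof (rule ccontr)
      assume "\<not> c < l ! i"
      then have "r \<le> i" using that R unfolding r by (intro Min_le) auto
      then show False using that by simp
    qed
    have rk: "r < k"
    proof (rule ccontr)
      assume "\<not> r < k"
      then have "k - 1 < r" using k0 by linarith
      then show False using R3[of "k - 1"] ck by simp
    qed
    have ge_r: "l ! i \<le> c" if "r \<le> i" "i < d" for i
      using sorted_desc_nth[OF sorted that(1)] that R(2) d by force
    \<comment> \<open>The third case of \<open>nu_vec\<close> is the second one with r = 0, because
      t >= \<open>s_star_star\<close> means that c is at least \<open>l ! 0\<close>.\<close>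
    have nu: "nu_vec l m t = take r l @ replicate (d - k) c @ drop r (take k l)"
    proof (cases "t < s_star_star l k")
      case True
      then show ?thesis using False by (simp add: nu_vec_def Let_def k c_def[symmetric] r_def[symmetric] d)
    next
      case F: False
      then have "(real d - real k) * l ! 0 \<le> (real d - real k) * c"
        using cd by (simp add: s_star_star_def d)
      then have "l ! 0 \<le> c" using kd by simp
      then have "r = 0" using R3[of 0] by force
      then show ?thesis using False F by (simp add: nu_vec_def Let_def k c_def[symmetric] r_def[symmetric] d)
    qed
    have tk: "take k l = take r l @ drop r (take k l)"
      using append_take_drop_id[of r "take k l"] rk by (simp add: min_def)
    have len: "length (nu_vec l m t) = d" using rk kd d by (simp add: nu)
    show thesis
    proof (rule that[of c])
      show "0 \<le> c" using R nth_nonneg[of r] by simp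
      have "c \<le> x" if "x \<in> set (take r l)" for x
        using that R3 by (force simp: in_set_conv_nth)
      moreover have "x \<le> c" if "x \<in> set (drop r (take k l))" for x
        using that ge_r kd d by (force simp: in_set_conv_nth)
      moreover have "sorted_wrt (\<ge>) (replicate (d - k) c)" by (auto simp: sorted_wrt_iff_nth_less)
      ultimately show "sorted_wrt (\<ge>) (nu_vec l m t)"
        unfolding nu sorted_wrt_append
        using sorted by (auto simp: sorted_wrt_take sorted_wrt_drop intro: order_trans)
      have "sum_list (nu_vec l m t) = sum_list (take r l @ drop r (take k l)) + (real d - real k) * c"
        using kd by (simp add: nu sum_list_replicate of_nat_diff)
      then show "sum_list (nu_vec l m t) = t" using cd unfolding tk[symmetric] by simp
      have "map (max c) (drop k l) = replicate (d - k) c"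
      proof (rule nth_equalityI)
        fix i assume "i < length (map (max c) (drop k l))"
        then show "map (max c) (drop k l) ! i = replicate (d - k) c ! i"
          using ge_r[of "k + i"] rk d by (simp add: max_absorb1)
      qed (simp add: d)
      moreover have "mset (nu_vec l m t) = mset (take r l @ drop r (take k l)) + mset (replicate (d - k) c)"
        by (simp add: nu)
      ultimately show "mset (nu_vec l m t) = mset (take k l @ map (max c) (drop k l))"
        unfolding tk[symmetric] by simp
      show "(c \<le> nu_vec l m t ! i \<and> nu_vec l m t ! i \<le> \<mu> i) \<or> (\<mu> i \<le> nu_vec l m t ! i \<and> nu_vec l m t ! i \<le> c)"
        if lo: "\<And>j. j < d \<Longrightarrow> l ! j \<le> \<mu> j"
          and hi: "\<And>j. d - k \<le> j \<Longrightarrow> j < d \<Longrightarrow> \<mu> j \<le> l ! (j - (d - k))" and i: "i < d" for \<mu> i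
      proof -
        \<comment> \<open>The top block exceeds c and is controlled by the lower bound on \<mu>; the
          middle block equals c; the bottom block is at most c, and there the shifted upper bound
          applies.\<close>
        consider "i < r" | "r \<le> i" "i < r + (d - k)" | "r + (d - k) \<le> i" by linarith
        then show ?thesis
        proof cases
          case 1
          have "nu_vec l m t ! i = take r l ! i"
            unfolding nu using 1 rk kd d by (subst nth_append_left) auto
          then have "nu_vec l m t ! i = l ! i" using 1 by simp
          then show ?thesis using R3[OF 1] lo[OF i] by simp
        next
          case 2
          have "nu_vec l m t ! i = (replicate (d - k) c @ drop r (take k l)) ! (i - r)"
            unfolding nu using 2 rk kd d by (subst nth_append_right) auto
          also have "\<dots> = c" using 2 by (subst nth_append_left) auto
          finally show ?thesis by auto
        next
          case 3
          have "nu_vec l m t ! i = (replicate (d - k) c @ drop r (take k l)) ! (i - r)"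
            unfolding nu using 3 rk kd d by (subst nth_append_right) auto
          also have "\<dots> = drop r (take k l) ! (i - r - (d - k))"
            using 3 by (subst nth_append_right) auto
          also have "\<dots> = take k l ! (r + (i - r - (d - k)))"
            using 3 i rk kd d by (intro nth_drop) auto
          also have "r + (i - r - (d - k)) = i - (d - k)" using 3 by simp
          also have "take k l ! (i - (d - k)) = l ! (i - (d - k))" using 3 i kd by (intro nth_take) simp
          finally have "nu_vec l m t ! i = l ! (i - (d - k))" .
          moreover have "l ! (i - (d - k)) \<le> c" using ge_r[of "i - (d - k)"] 3 i kd by simp
          ultimately show ?thesis using hi[of i] 3 i by auto
        qed
      qed
    qed (rule len)
  qed
qed

section \<open>Hermitian matrices\<close>

lemma mat_adjoint_carrier [simp]: "A \<in> carrier_mat m n \<Longrightarrow> mat_adjoint A \<in> carrier_mat n m"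
  by (auto simp: mat_adjoint_def)

lemma mat_adjoint_dims [simp]:
  "dim_row (mat_adjoint A) = dim_col A" "dim_col (mat_adjoint A) = dim_row A"
  by (auto simp: mat_adjoint_def)

lemma mat_adjoint_index [simp]:
  "i < dim_col A \<Longrightarrow> j < dim_row A \<Longrightarrow> mat_adjoint A $$ (i, j) = conjugate (A $$ (j, i))"
  by (auto simp: mat_adjoint_def mat_of_rows_def)

lemma mat_adjoint_mult:
  assumes "(A :: complex mat) \<in> carrier_mat m k" "B \<in> carrier_mat k n"
  shows "mat_adjoint (A * B) = mat_adjoint B * mat_adjoint A"
proof (intro eq_matI)
  fix i j assume "i < dim_row (mat_adjoint B * mat_adjoint A)" "j < dim_col (mat_adjoint B * mat_adjoint A)"
  then have ij: "i < n" "j < m" using assms by auto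
  have "mat_adjoint (A * B) $$ (i, j) = (\<Sum>l<k. cnj (A $$ (j, l)) * cnj (B $$ (l, i)))"
    using ij assms by (auto simp: scalar_prod_def atLeast0LessThan)
  also have "\<dots> = (\<Sum>l<k. cnj (B $$ (l, i)) * cnj (A $$ (j, l)))"
    by (intro sum.cong refl mult.commute)
  also have "\<dots> = (mat_adjoint B * mat_adjoint A) $$ (i, j)"
    using ij assms by (auto simp: scalar_prod_def atLeast0LessThan)
  finally show "mat_adjoint (A * B) $$ (i, j) = (mat_adjoint B * mat_adjoint A) $$ (i, j)" .
qed (use assms in auto)

lemma mat_adjoint_adjoint [simp]: "mat_adjoint (mat_adjoint A) = (A :: complex mat)"
  by (intro eq_matI) auto

lemma mat_adjoint_add:
  assumes "(A :: complex mat) \<in> carrier_mat m n" "B \<in> carrier_mat m n"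
  shows "mat_adjoint (A + B) = mat_adjoint A + mat_adjoint B"
  using assms by (intro eq_matI) auto

lemma mat_adjoint_one [simp]: "mat_adjoint (1\<^sub>m n) = (1\<^sub>m n :: complex mat)"
  by (intro eq_matI) auto

lemma mat_adjoint_zero [simp]: "mat_adjoint (0\<^sub>m m n) = (0\<^sub>m n m :: complex mat)"
  by (intro eq_matI) auto

lemma inner_mat_adjoint:
  assumes "(A :: complex mat) \<in> carrier_mat m n" "x \<in> carrier_vec n" "y \<in> carrier_vec m"
  shows "(A *\<^sub>v x) \<bullet>c y = x \<bullet>c (mat_adjoint A *\<^sub>v y)"
proof -
  have "(A *\<^sub>v x) \<bullet>c y = (\<Sum>i<m. \<Sum>j<n. A $$ (i, j) * x $ j * cnj (y $ i))"
    using assms by (auto simp: scalar_prod_def sum_distrib_right atLeast0LessThan intro!: sum.cong)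
  also have "\<dots> = (\<Sum>j<n. \<Sum>i<m. A $$ (i, j) * x $ j * cnj (y $ i))"
    by (rule sum.swap)
  also have "\<dots> = x \<bullet>c (mat_adjoint A *\<^sub>v y)"
    using assms by (auto simp: scalar_prod_def sum_distrib_left atLeast0LessThan mult_ac intro!: sum.cong)
  finally show ?thesis .
qed

lemma inner_comm_conj:
  assumes "(x :: complex vec) \<in> carrier_vec n" "r \<in> carrier_vec n"
  shows "conjugate r \<bullet> x = x \<bullet>c r"
  using assms by (simp add: comm_scalar_prod[of _ n])

lemma inner_cnj:
  assumes "(x :: complex vec) \<in> carrier_vec n" "y \<in> carrier_vec n"
  shows "x \<bullet>c y = cnj (y \<bullet>c x)"
  using conjugate_vec_sprod_comm[OF assms(2,1)] conjugate_conjugate_sprod[OF assms] by simp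

lemma row_mat_adjoint: "i < dim_col A \<Longrightarrow> row (mat_adjoint A) i = conjugate (col A i)"
  by (intro eq_vecI) auto

lemma mat_adjoint_mult_vec_index:
  assumes "(A :: complex mat) \<in> carrier_mat m n" "x \<in> carrier_vec m" "i < n"
  shows "(mat_adjoint A *\<^sub>v x) $ i = x \<bullet>c col A i"
proof -
  have "(mat_adjoint A *\<^sub>v x) $ i = conjugate (col A i) \<bullet> x"
    using assms by (simp add: row_mat_adjoint)
  then show ?thesis using inner_comm_conj[of x m "col A i"] assms by simp
qed

lemma inner_self: "x \<bullet>c x = complex_of_real (\<Sum>i<dim_vec x. (cmod (x $ i))\<^sup>2)"
  by (auto simp: scalar_prod_def atLeast0LessThan complex_norm_square simp del: of_real_power intro!: sum.cong)

section \<open>Linear equations and orthonormal systems\<close>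

text \<open>Padding with zero rows makes the coefficient matrix square with a zero last row, so its
  transpose annihilates the last unit vector and the determinant vanishes. The product
  \<open>\<bullet>\<close> is bilinear; orthogonality conditions enter through conjugated
  vectors.\<close>

lemma exists_common_zero:
  fixes rs :: "complex vec list"
  assumes "set rs \<subseteq> carrier_vec n" "length rs < n"
  shows "\<exists>x \<in> carrier_vec n. x \<noteq> 0\<^sub>v n \<and> (\<forall>r \<in> set rs. r \<bullet> x = 0)"
proof -
  define A where "A = mat n n (\<lambda>(i, j). if i < length rs then rs ! i $ j else 0)"
  have A: "A \<in> carrier_mat n n" by (simp add: A_def)
  have "transpose_mat A *\<^sub>v unit_vec n (n - 1) = 0\<^sub>v n"
    using assms(2) by (intro eq_vecI) (auto simp: A_def)
  then have "det (transpose_mat A) = 0"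
    using assms(2) A by (subst det_0_iff_vec_prod_zero[of _ n]) (auto intro!: exI[of _ "unit_vec n (n - 1)"])
  then have "det A = 0" using det_transpose[OF A] by simp
  then obtain x where x: "x \<in> carrier_vec n" "x \<noteq> 0\<^sub>v n" "A *\<^sub>v x = 0\<^sub>v n"
    unfolding det_0_iff_vec_prod_zero[OF A] by auto
  have "r \<bullet> x = 0" if r: "r \<in> set rs" for r
  proof -
    obtain i where i: "i < length rs" "rs ! i = r" using r by (auto simp: in_set_conv_nth)
    have "row A i = r"
      using i assms r by (intro eq_vecI) (auto simp: A_def)
    then have "(A *\<^sub>v x) $ i = r \<bullet> x" using i assms A by simp
    then show ?thesis using x(3) i assms(2) by simp
  qed
  with x show ?thesis by blast
qed

text \<open>Phrased through the set of vectors and distinctness, and not through indices, so that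
  reordering the list visibly preserves it.\<close>

definition orthonormal :: "nat \<Rightarrow> complex vec list \<Rightarrow> bool" where
  "orthonormal n vs \<longleftrightarrow> set vs \<subseteq> carrier_vec n \<and> distinct vs \<and> (\<forall>v \<in> set vs. v \<bullet>c v = 1) \<and>
     (\<forall>v \<in> set vs. \<forall>w \<in> set vs. v \<noteq> w \<longrightarrow> v \<bullet>c w = 0)"

lemma orthonormal_nth:
  assumes "orthonormal n vs" "i < length vs"
  shows "vs ! i \<in> carrier_vec n" "dim_vec (vs ! i) = n"
proof -
  show "vs ! i \<in> carrier_vec n"
    using assms subsetD[OF _ nth_mem[OF assms(2)]] unfolding orthonormal_def by blast
  then show "dim_vec (vs ! i) = n" by simp
qed

lemma orthonormal_adjoint_mult:
  assumes "orthonormal n vs"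
  shows "mat_adjoint (mat_of_cols n vs) * mat_of_cols n vs = 1\<^sub>m (length vs)"
proof (intro eq_matI)
  fix i j assume ij: "i < dim_row (1\<^sub>m (length vs))" "j < dim_col (1\<^sub>m (length vs))"
  have c: "vs ! i \<in> carrier_vec n" "vs ! j \<in> carrier_vec n" "dim_vec (vs ! i) = n"
    using ij orthonormal_nth[OF assms] by auto
  have "(mat_adjoint (mat_of_cols n vs) * mat_of_cols n vs) $$ (i, j) =
      (mat_adjoint (mat_of_cols n vs) *\<^sub>v vs ! j) $ i"
    using ij c by simp
  also have "\<dots> = vs ! j \<bullet>c (vs ! i)"
    using ij c mat_adjoint_mult_vec_index[of "mat_of_cols n vs" n "length vs" "vs ! j" i] by simp
  also have "\<dots> = (if i = j then 1 else 0)"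
    using assms ij unfolding orthonormal_def by (auto simp: nth_eq_iff_index_eq)
  finally show "(mat_adjoint (mat_of_cols n vs) * mat_of_cols n vs) $$ (i, j) = 1\<^sub>m (length vs) $$ (i, j)"
    using ij by simp
qed auto

lemma normalize_vec:
  assumes "(x :: complex vec) \<in> carrier_vec n" "x \<noteq> 0\<^sub>v n"
  obtains a where "a \<noteq> 0" "(a \<cdot>\<^sub>v x) \<bullet>c (a \<cdot>\<^sub>v x) = 1"
proof -
  define s where "s = (\<Sum>i<n. (cmod (x $ i))\<^sup>2)"
  have xx: "x \<bullet>c x = complex_of_real s" using inner_self[of x] assms(1) by (simp add: s_def)
  have "s \<ge> 0" unfolding s_def by (intro sum_nonneg) auto
  moreover have "s \<noteq> 0" using xx assms conjugate_square_eq_0_vec[of x n] by auto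
  ultimately have s: "s > 0" by simp
  define b where "b = 1 / sqrt s"
  define a where "a = complex_of_real b"
  have "(a \<cdot>\<^sub>v x) \<bullet>c (a \<cdot>\<^sub>v x) = a * cnj a * (x \<bullet>c x)"
    using assms(1) by (auto simp: conjugate_smult_vec)
  also have "\<dots> = complex_of_real (b * b * s)" unfolding xx a_def by simp
  also have "b * b * s = 1" using s by (simp add: b_def)
  finally show ?thesis using that[of a] s by (auto simp: a_def b_def)
qed

lemma orthonormal_Cons:
  assumes "orthonormal n vs" "x \<in> carrier_vec n" "x \<bullet>c x = 1" "\<And>v. v \<in> set vs \<Longrightarrow> x \<bullet>c v = 0"
  shows "orthonormal n (x # vs)"
proof -
  have "v \<bullet>c x = 0" if "v \<in> set vs" for v
    using that assms(1,2) inner_cnj[of v n x] assms(4)[OF that] unfolding orthonormal_def by auto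
  then show ?thesis using assms unfolding orthonormal_def by auto
qed

text \<open>A greedy choice: each new vector solves fewer than n equations and is then normalised.
  Only the length of cs is counted, so cs may be dependent. Used for the complement of known
  eigenvectors and for the complement of the range of an analysis operator.\<close>

lemma exists_orthonormal_perp:
  fixes cs :: "complex vec list"
  assumes "set cs \<subseteq> carrier_vec n" "length cs + k \<le> n"
  shows "\<exists>zs. orthonormal n zs \<and> length zs = k \<and> (\<forall>z \<in> set zs. \<forall>c \<in> set cs. z \<bullet>c c = 0)"
  using assms(2)
proof (induction k)
  case 0
  then show ?case by (intro exI[of _ "[]"]) (auto simp: orthonormal_def)
next
  case (Suc k)
  then obtain zs where zs: "orthonormal n zs" "length zs = k" "\<forall>z \<in> set zs. \<forall>c \<in> set cs. z \<bullet>c c = 0"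
    by auto
  have zc: "set zs \<subseteq> carrier_vec n" using zs(1) by (simp add: orthonormal_def)
  have "set (map conjugate (cs @ zs)) \<subseteq> carrier_vec n" "length (map conjugate (cs @ zs)) < n"
    using assms(1) zc zs(2) Suc.prems by auto
  from exists_common_zero[OF this] obtain x
    where x: "x \<in> carrier_vec n" "x \<noteq> 0\<^sub>v n" "\<forall>r \<in> set (map conjugate (cs @ zs)). r \<bullet> x = 0"
    by blast
  have perp: "x \<bullet>c r = 0" if "r \<in> set cs \<union> set zs" for r
    using x(3) that inner_comm_conj[OF x(1), of r] zc assms(1) by auto
  obtain a where a: "a \<noteq> 0" "(a \<cdot>\<^sub>v x) \<bullet>c (a \<cdot>\<^sub>v x) = 1"
    by (rule normalize_vec[OF x(1,2)])
  have perp': "(a \<cdot>\<^sub>v x) \<bullet>c r = 0" if "r \<in> set cs \<union> set zs" for r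
    using perp[OF that] x(1) that zc assms(1) by (auto simp: subset_iff)
  have "orthonormal n (a \<cdot>\<^sub>v x # zs)"
    using zs(1) x(1) a perp' by (intro orthonormal_Cons) auto
  then show ?case using zs perp' by (intro exI[of _ "a \<cdot>\<^sub>v x # zs"]) auto
qed

text \<open>A square matrix U with orthonormal columns has its adjoint as a right inverse too, so x
  is recovered by U from its products with vs, which all vanish.\<close>

lemma orthonormal_complete:
  assumes "orthonormal n vs" "length vs = n" "x \<in> carrier_vec n" "\<And>v. v \<in> set vs \<Longrightarrow> x \<bullet>c v = 0"
  shows "x = 0\<^sub>v n"
proof -
  define U where "U = mat_of_cols n vs"
  have U: "U \<in> carrier_mat n n" using assms(2) by (auto simp: U_def)
  have "mat_adjoint U * U = 1\<^sub>m n" using orthonormal_adjoint_mult[OF assms(1)] assms(2) by (simp add: U_def)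
  then have UU: "U * mat_adjoint U = 1\<^sub>m n" using mat_mult_left_right_inverse[OF mat_adjoint_carrier[OF U] U] by simp
  have "mat_adjoint U *\<^sub>v x = 0\<^sub>v n"
  proof (rule eq_vecI)
    fix i assume i: "i < dim_vec (0\<^sub>v n)"
    then have c: "vs ! i \<in> carrier_vec n" "dim_vec (vs ! i) = n" "vs ! i \<in> set vs" using assms(2) orthonormal_nth[OF assms(1), of i] by auto
    have "(mat_adjoint U *\<^sub>v x) $ i = x \<bullet>c (vs ! i)"
      using i c assms(2) mat_adjoint_mult_vec_index[OF U assms(3), of i] by (simp add: U_def)
    then show "(mat_adjoint U *\<^sub>v x) $ i = 0\<^sub>v n $ i" using assms(4) c(3) i by simp
  qed (use U in auto)
  then have "(U * mat_adjoint U) *\<^sub>v x = 0\<^sub>v n"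
    using U assms(3) by (subst assoc_mult_mat_vec[of _ n n _ n]) auto
  then show ?thesis using UU assms(3) by simp
qed

section \<open>The spectral theorem for Hermitian matrices\<close>

lemma exists_eigenvector:
  assumes "(A :: complex mat) \<in> carrier_mat n n" "0 < n"
  obtains e v where "v \<in> carrier_vec n" "v \<noteq> 0\<^sub>v n" "A *\<^sub>v v = e \<cdot>\<^sub>v v"
proof -
  obtain e where "eigenvalue A e" using spectrum_non_empty[OF assms] by (auto simp: spectrum_def)
  then obtain v where "eigenvector A v e" by (auto simp: eigenvalue_def)
  then show ?thesis using assms(1) that[of v e] by (simp add: eigenvector_def)
qed

text \<open>The next eigenvector comes from the compression \<open>C\<close> of \<open>A\<close> to the orthogonal complement of
  the eigenvectors found so far, which is invariant under \<open>A\<close>.\<close>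

lemma hermitian_eigenpairs:
  assumes A: "(A :: complex mat) \<in> carrier_mat n n" "mat_adjoint A = A" and "k \<le> n"
  shows "\<exists>ps :: (real \<times> complex vec) list. length ps = k \<and> orthonormal n (map snd ps) \<and>
    (\<forall>(e, v) \<in> set ps. A *\<^sub>v v = complex_of_real e \<cdot>\<^sub>v v)"
  using assms(3)
proof (induction k)
  case 0
  then show ?case by (intro exI[of _ "[]"]) (auto simp: orthonormal_def)
next
  case (Suc k)
  then obtain ps :: "(real \<times> complex vec) list" where ps: "length ps = k" "orthonormal n (map snd ps)"
    "\<forall>(e, v) \<in> set ps. A *\<^sub>v v = complex_of_real e \<cdot>\<^sub>v v" by auto
  define vs where "vs = map snd ps"
  define m where "m = n - k"
  have m: "0 < m" using Suc.prems by (simp add: m_def)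
  have vs: "orthonormal n vs" "set vs \<subseteq> carrier_vec n" "length vs + m \<le> n"
    using ps Suc.prems by (auto simp: vs_def orthonormal_def m_def)
  have Av: "\<exists>e. A *\<^sub>v v = complex_of_real e \<cdot>\<^sub>v v" if "v \<in> set vs" for v
    using that ps(3) unfolding vs_def by fastforce
  obtain zs where zs: "orthonormal n zs" "length zs = m" "\<forall>z \<in> set zs. \<forall>v \<in> set vs. z \<bullet>c v = 0"
    using exists_orthonormal_perp[OF vs(2,3)] by blast
  have zc: "set zs \<subseteq> carrier_vec n" using zs(1) by (simp add: orthonormal_def)
  define Z where "Z = mat_of_cols n zs"
  have Z: "Z \<in> carrier_mat n m" using zs(2) by (auto simp: Z_def)
  have ZZ: "mat_adjoint Z * Z = 1\<^sub>m m" using orthonormal_adjoint_mult[OF zs(1)] zs(2) by (simp add: Z_def)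
  define C where "C = mat_adjoint Z * (A * Z)"
  have C: "C \<in> carrier_mat m m" unfolding C_def using A Z by auto
  obtain e p where p: "p \<in> carrier_vec m" "p \<noteq> 0\<^sub>v m" "C *\<^sub>v p = e \<cdot>\<^sub>v p"
    by (rule exists_eigenvector[OF C m])
  define x where "x = Z *\<^sub>v p"
  have x: "x \<in> carrier_vec n" using Z p by (auto simp: x_def)
  have Zx: "mat_adjoint Z *\<^sub>v x = p"
    using assoc_mult_mat_vec[OF mat_adjoint_carrier[OF Z] Z p(1)] ZZ p by (simp add: x_def)
  have "x \<noteq> 0\<^sub>v n"
  proof
    assume "x = 0\<^sub>v n"
    then have "p = 0\<^sub>v m" using Zx Z by auto
    then show False using p(2) by simp
  qed
  have ZAx: "mat_adjoint Z *\<^sub>v (A *\<^sub>v x) = e \<cdot>\<^sub>v p"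
    using p A Z assoc_mult_mat_vec[OF mat_adjoint_carrier[OF Z] mult_carrier_mat[OF A(1) Z] p(1)]
      assoc_mult_mat_vec[OF A(1) Z p(1)] by (simp add: x_def C_def)
  have xv: "x \<bullet>c v = 0" if "v \<in> set vs" for v
  proof -
    have v: "v \<in> carrier_vec n" using that vs by auto
    have "mat_adjoint Z *\<^sub>v v = 0\<^sub>v m"
    proof (rule eq_vecI)
      fix i assume i: "i < dim_vec (0\<^sub>v m)"
      then have "(mat_adjoint Z *\<^sub>v v) $ i = v \<bullet>c (zs ! i)"
        using mat_adjoint_mult_vec_index[OF Z v, of i] zs(2) orthonormal_nth[OF zs(1), of i]
        by (simp add: Z_def)
      also have "\<dots> = cnj (zs ! i \<bullet>c v)"
        using inner_cnj[OF v, of "zs ! i"] orthonormal_nth[OF zs(1), of i] zs(2) i by simp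
      also have "\<dots> = 0" using zs(2,3) that i by simp
      finally show "(mat_adjoint Z *\<^sub>v v) $ i = 0\<^sub>v m $ i" using i by simp
    qed (use Z in auto)
    then show ?thesis using inner_mat_adjoint[OF Z p(1) v] p(1) by (simp add: x_def)
  qed
  \<comment> \<open>The eigenvector equation of C only says that this residual is orthogonal to zs.
    Orthogonality to vs comes from A being Hermitian, as x is orthogonal to the eigenvectors in vs.
    Together vs and zs have n members.\<close>
  define y where "y = A *\<^sub>v x - e \<cdot>\<^sub>v x"
  have y: "y \<in> carrier_vec n" using A x by (auto simp: y_def)
  have yw: "y \<bullet>c w = (A *\<^sub>v x) \<bullet>c w - e * (x \<bullet>c w)" if "w \<in> carrier_vec n" for w
    using that A x unfolding y_def by (subst minus_scalar_prod_distrib[of _ n]) auto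
  have "y = 0\<^sub>v n"
  proof (rule orthonormal_complete[of n "vs @ zs"])
    have "v \<bullet>c z = 0" if "v \<in> set vs" "z \<in> set zs" for v z
      using inner_cnj[of v n z] zs(3) that vs(2) zc by (auto simp: subset_iff)
    moreover have "v \<noteq> z" if "v \<in> set vs" "z \<in> set zs" for v z
      using zs(1,3) that unfolding orthonormal_def by force
    ultimately show "orthonormal n (vs @ zs)"
      using vs(1) zs(1,3) unfolding orthonormal_def by auto
  next
    fix w assume "w \<in> set (vs @ zs)"
    then consider "w \<in> set vs" | i where "i < m" "w = zs ! i"
      using zs(2) by (auto simp: in_set_conv_nth)
    then show "y \<bullet>c w = 0"
    proof cases
      case 1
      then have w: "w \<in> carrier_vec n" using vs by auto
      obtain e' where "A *\<^sub>v w = complex_of_real e' \<cdot>\<^sub>v w" using Av 1 by blast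
      then have "(A *\<^sub>v x) \<bullet>c w = complex_of_real e' * (x \<bullet>c w)"
        using inner_mat_adjoint[OF A(1) x w] x w A(2) by (simp add: conjugate_smult_vec)
      then show ?thesis using yw[OF w] xv[OF 1] by simp
    next
      case 2
      have w: "w \<in> carrier_vec n" using 2 zs(2) orthonormal_nth[OF zs(1)] by simp
      have colZ: "col Z i = w" using 2 w zs(2) by (simp add: Z_def)
      have "(A *\<^sub>v x) \<bullet>c w = (e \<cdot>\<^sub>v p) $ i"
        using mat_adjoint_mult_vec_index[OF Z, of "A *\<^sub>v x" i] 2(1) A x
        unfolding ZAx colZ by simp
      moreover have "x \<bullet>c w = p $ i"
        using mat_adjoint_mult_vec_index[OF Z x 2(1)] unfolding Zx colZ by simp
      ultimately show ?thesis using yw[OF w] p(1) 2 by simp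
    qed
  qed (use vs y zs ps Suc.prems in \<open>auto simp: vs_def m_def\<close>)
  have Ax: "A *\<^sub>v x = e \<cdot>\<^sub>v x"
  proof (rule eq_vecI)
    fix i assume "i < dim_vec (e \<cdot>\<^sub>v x)"
    then have i: "i < n" using x by simp
    have "y $ i = 0" using \<open>y = 0\<^sub>v n\<close> i by simp
    then show "(A *\<^sub>v x) $ i = (e \<cdot>\<^sub>v x) $ i" using i x A by (simp add: y_def)
  qed (use A x in auto)
  obtain a where a: "a \<noteq> 0" "(a \<cdot>\<^sub>v x) \<bullet>c (a \<cdot>\<^sub>v x) = 1"
    by (rule normalize_vec[OF x \<open>x \<noteq> 0\<^sub>v n\<close>])
  define u where "u = a \<cdot>\<^sub>v x"
  have u: "u \<in> carrier_vec n" "u \<bullet>c u = 1" using x a by (auto simp: u_def)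
  have Au: "A *\<^sub>v u = e \<cdot>\<^sub>v u"
    using A x Ax by (simp add: u_def mult_mat_vec smult_smult_assoc mult.commute)
  have "e = (A *\<^sub>v u) \<bullet>c u" using u by (simp add: Au)
  also have "\<dots> = u \<bullet>c (e \<cdot>\<^sub>v u)" using inner_mat_adjoint[OF A(1) u(1) u(1)] A(2) Au by simp
  also have "\<dots> = cnj e" using u by (simp add: conjugate_smult_vec)
  finally have "e \<in> \<real>" by (simp add: Reals_cnj_iff)
  then obtain e' where e': "e = complex_of_real e'" by (auto elim: Reals_cases)
  have "u \<bullet>c v = 0" if "v \<in> set vs" for v
    using xv[OF that] x that vs(2) by (auto simp: u_def subset_iff)
  then have "orthonormal n (u # vs)" using vs(1) u by (intro orthonormal_Cons) auto
  then show ?case using ps Au e' by (intro exI[of _ "(e', u) # ps"]) (auto simp: vs_def)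
qed

text \<open>No order is imposed on l: the perturbed spectrum built later is unsorted in the
  eigenbasis of the unperturbed matrix.\<close>

definition unitary_diag :: "complex mat \<Rightarrow> real list \<Rightarrow> complex mat \<Rightarrow> bool" where
  "unitary_diag U l A \<longleftrightarrow> U \<in> carrier_mat (length l) (length l) \<and>
     mat_adjoint U * U = 1\<^sub>m (length l) \<and>
     A = U * mat_diag (length l) (\<lambda>i. complex_of_real (l ! i)) * mat_adjoint U"

lemma unitary_right_inverse:
  assumes "(U :: complex mat) \<in> carrier_mat n n" "mat_adjoint U * U = 1\<^sub>m n"
  shows "U * mat_adjoint U = 1\<^sub>m n"
  by (rule mat_mult_left_right_inverse[OF mat_adjoint_carrier[OF assms(1)] assms])

lemma hermitian_unitary_diag:
  assumes A: "(A :: complex mat) \<in> carrier_mat n n" "mat_adjoint A = A"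
  shows "\<exists>U l. length l = n \<and> sorted_wrt (\<ge>) l \<and> unitary_diag U l A"
proof -
  obtain qs :: "(real \<times> complex vec) list" where qs: "length qs = n" "orthonormal n (map snd qs)"
    "\<forall>(e, v) \<in> set qs. A *\<^sub>v v = complex_of_real e \<cdot>\<^sub>v v"
    using hermitian_eigenpairs[OF A order_refl] by blast
  define ps where "ps = rev (sort_key fst qs)"
  have mset: "mset ps = mset qs" by (simp add: ps_def)
  have "mset (map snd ps) = mset (map snd qs)" using mset by simp
  then have orth: "orthonormal n (map snd ps)"
    using qs(2) mset_eq_setD[of "map snd ps" "map snd qs"] mset_eq_imp_distinct_iff[of "map snd ps" "map snd qs"]
    unfolding orthonormal_def by metis
  have len: "length ps = n" using qs(1) by (simp add: ps_def)
  have ev: "A *\<^sub>v snd (ps ! i) = complex_of_real (fst (ps ! i)) \<cdot>\<^sub>v snd (ps ! i)" if "i < n" for i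
  proof -
    have "ps ! i \<in> set qs" using nth_mem[of i ps] that len by (simp add: ps_def)
    then show ?thesis using qs(3) by (auto split: prod.splits)
  qed
  have sorted: "sorted_wrt (\<ge>) (map fst ps)"
    using sorted_sort_key[of fst qs] by (simp add: ps_def rev_map[symmetric] sorted_wrt_rev)
  define U where "U = mat_of_cols n (map snd ps)"
  have U: "U \<in> carrier_mat n n" using len by (auto simp: U_def)
  have UU: "mat_adjoint U * U = 1\<^sub>m n" using orthonormal_adjoint_mult[OF orth] len by (simp add: U_def)
  define D where "D = mat_diag n (\<lambda>i. complex_of_real (map fst ps ! i))"
  have D: "D \<in> carrier_mat n n" by (simp add: D_def)
  have "A * U = U * D"
  proof (rule eq_matI)
    fix i j assume "i < dim_row (U * D)" "j < dim_col (U * D)"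
    then have ij: "i < n" "j < n" using U D by auto
    have c: "col U j = snd (ps ! j)" using ij len orthonormal_nth[OF orth, of j] by (simp add: U_def)
    have dv: "dim_vec (snd (ps ! j)) = n" using ij len orthonormal_nth[OF orth, of j] by simp
    have "(A * U) $$ (i, j) = (A *\<^sub>v col U j) $ i" using ij A U by simp
    also have "\<dots> = complex_of_real (fst (ps ! j)) * col U j $ i"
      using ev[OF ij(2)] c dv ij by simp
    also have "\<dots> = (U * D) $$ (i, j)"
      using ij U len by (simp add: D_def mat_diag_mult_right[OF U] mult.commute)
    finally show "(A * U) $$ (i, j) = (U * D) $$ (i, j)" .
  qed (use A U D in auto)
  then have "U * D * mat_adjoint U = A * (U * mat_adjoint U)"
    using assoc_mult_mat[OF A(1) U mat_adjoint_carrier[OF U]] by simp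
  then have "A = U * D * mat_adjoint U" using unitary_right_inverse[OF U UU] A by simp
  then have "unitary_diag U (map fst ps) A"
    using U UU len unfolding unitary_diag_def D_def by simp
  then show ?thesis using sorted len by (intro exI[of _ U] exI[of _ "map fst ps"]) simp
qed

section \<open>The sorted spectrum is well defined\<close>

lemma char_poly_unitary_diag:
  assumes "unitary_diag U l A"
  shows "char_poly A = (\<Prod>a\<leftarrow>l. [:- complex_of_real a, 1:])"
proof -
  define n where "n = length l"
  define D where "D = mat_diag n (\<lambda>i. complex_of_real (l ! i))"
  have U: "U \<in> carrier_mat n n" and UU: "mat_adjoint U * U = 1\<^sub>m n"
    and A: "A = U * D * mat_adjoint U"
    using assms by (auto simp: unitary_diag_def n_def D_def)
  have D: "D \<in> carrier_mat n n" by (simp add: D_def)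
  have "similar_mat_wit A D U (mat_adjoint U)"
    using U UU D unitary_right_inverse[OF U UU] unfolding similar_mat_wit_def A Let_def by auto
  then have "char_poly A = char_poly D" by (intro char_poly_similar) (auto simp: similar_mat_def)
  also have "\<dots> = (\<Prod>a\<leftarrow>diag_mat D. [:- a, 1:])"
    by (rule char_poly_upper_triangular[OF D]) (auto simp: D_def mat_diag_def upper_triangular_def)
  also have "diag_mat D = map complex_of_real l"
    by (rule nth_equalityI) (auto simp: diag_mat_def D_def mat_diag_def n_def)
  finally show ?thesis by (simp add: o_def)
qed

text \<open>Both heads are the maximum of the common set of roots, so they agree, and their linear
  factor cancels. This is the uniqueness behind the description in \<open>eigs\<close>.\<close>

lemma sorted_linear_factors_unique:
  fixes xs ys :: "real list"
  assumes "sorted_wrt (\<ge>) xs" "sorted_wrt (\<ge>) ys"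
    and "(\<Prod>a\<leftarrow>xs. [:- complex_of_real a, 1:]) = (\<Prod>a\<leftarrow>ys. [:- complex_of_real a, 1:])"
  shows "xs = ys"
proof -
  have root: "poly (\<Prod>a\<leftarrow>zs. [:- complex_of_real a, 1:]) (complex_of_real b) = 0 \<longleftrightarrow> b \<in> set zs"
    for zs and b :: real
    by (induction zs) auto
  have nz: "(\<Prod>a\<leftarrow>zs. [:- complex_of_real a, 1:]) \<noteq> 0" for zs :: "real list"
    by (auto simp: prod_list_zero_iff)
  have lem: "set xs = set ys"
    if "(\<Prod>a\<leftarrow>xs. [:- complex_of_real a, 1:]) = (\<Prod>a\<leftarrow>ys. [:- complex_of_real a, 1:])" for xs ys :: "real list"
    using that root by (metis subsetI subset_antisym)
  show ?thesis
    using assms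
  proof (induction xs arbitrary: ys)
    case Nil
    then show ?case using lem[of "[]" ys] by simp
  next
    case (Cons x xs)
    have s: "set (x # xs) = set ys" using Cons.prems(3) by (rule lem)
    then obtain y ys' where ys: "ys = y # ys'" by (cases ys) auto
    have "x \<ge> y" "y \<ge> x" using s Cons.prems(1,2) by (auto simp: ys)
    then have xy: "x = y" by simp
    have "[:- complex_of_real x, 1:] \<noteq> 0" by simp
    then have "(\<Prod>a\<leftarrow>xs. [:- complex_of_real a, 1:]) = (\<Prod>a\<leftarrow>ys'. [:- complex_of_real a, 1:])"
      using Cons.prems(3) unfolding ys xy list.map prod_list.Cons mult_cancel_left by blast
    then show ?case using Cons ys xy by simp
  qed
qed

lemma eigs_eq:
  assumes "unitary_diag U l A" "sorted_wrt (\<ge>) es" "mset es = mset l"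
  shows "eigs A = es"
proof -
  have "(\<Prod>a\<leftarrow>es. [:- complex_of_real a, 1:]) = (\<Prod>a\<leftarrow>l. [:- complex_of_real a, 1:])"
    using assms(3) by (metis mset_map prod_mset_prod_list)
  then have "char_poly A = (\<Prod>a\<leftarrow>es. [:- complex_of_real a, 1:])"
    using char_poly_unitary_diag[OF assms(1)] by simp
  then show ?thesis unfolding eigs_def
    using assms(2) sorted_linear_factors_unique by (intro the_equality) auto
qed

lemma hermitian_eigs:
  assumes "A \<in> carrier_mat n n" "mat_adjoint A = A"
  obtains U where "unitary_diag U (eigs A) A" "sorted_wrt (\<ge>) (eigs A)" "length (eigs A) = n"
  using hermitian_unitary_diag[OF assms] eigs_eq by metis

section \<open>Traces and the functional calculus\<close>

lemma mat_tr_comm: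
  assumes "A \<in> carrier_mat m n" "B \<in> carrier_mat n m"
  shows "mat_tr (A * B) = mat_tr (B * A)"
proof -
  have tr: "mat_tr C = (\<Sum>i<dim_row C. C $$ (i, i))" for C
    by (simp add: mat_tr_def diag_mat_def interv_sum_list_conv_sum_set_nat atLeast0LessThan)
  have "mat_tr (A * B) = (\<Sum>i<m. \<Sum>j<n. A $$ (i, j) * B $$ (j, i))"
    using assms by (simp add: tr scalar_prod_def atLeast0LessThan)
  also have "\<dots> = (\<Sum>j<n. \<Sum>i<m. A $$ (i, j) * B $$ (j, i))" by (rule sum.swap)
  also have "\<dots> = (\<Sum>j<n. \<Sum>i<m. B $$ (j, i) * A $$ (i, j))"
    by (intro sum.cong refl mult.commute)
  also have "\<dots> = mat_tr (B * A)"
    using assms by (simp add: tr scalar_prod_def atLeast0LessThan)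
  finally show ?thesis .
qed

lemma mat_tr_unitary_conj:
  assumes U: "U \<in> carrier_mat n n" and UU: "mat_adjoint U * U = 1\<^sub>m n"
  shows "mat_tr (U * mat_diag n g * mat_adjoint U) = (\<Sum>i<n. g i)"
proof -
  have D: "mat_diag n g \<in> carrier_mat n n" by simp
  have "mat_tr (U * mat_diag n g * mat_adjoint U) = mat_tr (mat_adjoint U * (U * mat_diag n g))"
    using U by (intro mat_tr_comm[of _ n n]) auto
  also have "mat_adjoint U * (U * mat_diag n g) = mat_diag n g"
    using assoc_mult_mat[OF mat_adjoint_carrier[OF U] U D] UU left_mult_one_mat[OF D] by simp
  finally show ?thesis
    by (simp add: mat_tr_def diag_mat_def mat_diag_def interv_sum_list_conv_sum_set_nat atLeast0LessThan)
qed

text \<open>Two diagonalisations of A differ by W, the product of the adjoint of U with V, and W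
  intertwines the diagonals. Entrywise, \<open>W $$ (i, j)\<close> is zero unless
  \<open>l ! i = \<mu> j\<close>; hence W also intertwines the diagonals after f has been
  applied.\<close>

lemma mat_fun_unitary_diag:
  assumes "unitary_diag U l A"
  shows "mat_fun f A = U * mat_diag (length l) (\<lambda>i. complex_of_real (f (l ! i))) * mat_adjoint U"
proof -
  define n where "n = length l"
  define D where "D = mat_diag n (\<lambda>i. complex_of_real (l ! i))"
  define fD where "fD = mat_diag n (\<lambda>i. complex_of_real (f (l ! i)))"
  have U: "U \<in> carrier_mat n n" and UU: "mat_adjoint U * U = 1\<^sub>m n"
    and A: "A = U * D * mat_adjoint U"
    using assms by (auto simp: unitary_diag_def n_def D_def)
  have dim: "dim_row A = n" using U by (simp add: A)
  note UU' = unitary_right_inverse[OF U UU]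
  have unique: "V * mat_diag n (\<lambda>i. complex_of_real (f (\<mu> i))) * mat_adjoint V = U * fD * mat_adjoint U"
    if V: "V \<in> carrier_mat n n" "mat_adjoint V * V = 1\<^sub>m n"
      and AV: "A = V * mat_diag n (\<lambda>i. complex_of_real (\<mu> i)) * mat_adjoint V" for V and \<mu> :: "nat \<Rightarrow> real"
  proof -
    define E where "E = mat_diag n (\<lambda>i. complex_of_real (\<mu> i))"
    define fE where "fE = mat_diag n (\<lambda>i. complex_of_real (f (\<mu> i)))"
    define W where "W = mat_adjoint U * V"
    have carr: "D \<in> carrier_mat n n" "fD \<in> carrier_mat n n" "E \<in> carrier_mat n n" "fE \<in> carrier_mat n n"
      "W \<in> carrier_mat n n" "mat_adjoint U \<in> carrier_mat n n" "mat_adjoint V \<in> carrier_mat n n"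
      using U V by (auto simp: D_def fD_def E_def fE_def W_def)
    note VV' = unitary_right_inverse[OF V]
    have assoc: "(X * Y) * Z = X * (Y * Z)" if "X \<in> carrier_mat n n" "Y \<in> carrier_mat n n" "Z \<in> carrier_mat n n"
      for X Y Z :: "complex mat" using assoc_mult_mat[OF that] .
    have "P * (Q * X) = X" if "P \<in> carrier_mat n n" "Q \<in> carrier_mat n n" "X \<in> carrier_mat n n" "P * Q = 1\<^sub>m n"
      for P Q X :: "complex mat"
      using assoc[OF that(1-3)] left_mult_one_mat[OF that(3)] that(4) by simp
    note cancel = this[OF carr(6) U _ UU] this[OF U carr(6) _ UU'] this[OF V(1) carr(7) _ VV']
    have "U * (D * W) = A * V"
      unfolding A by (simp only: assoc[OF mult_carrier_mat[OF U carr(1)] carr(6) V(1)] W_def[symmetric]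
          assoc[OF U carr(1) carr(5)])
    also have "\<dots> = V * E"
      unfolding AV E_def[symmetric]
      by (simp only: assoc[OF mult_carrier_mat[OF V(1) carr(3)] carr(7) V(1)] V(2)
          right_mult_one_mat[OF mult_carrier_mat[OF V(1) carr(3)]])
    finally have "mat_adjoint U * (U * (D * W)) = mat_adjoint U * (V * E)" by simp
    then have "D * W = mat_adjoint U * (V * E)"
      unfolding cancel(1)[OF mult_carrier_mat[OF carr(1,5)]] .
    then have DW: "D * W = W * E"
      unfolding W_def by (simp only: assoc[OF carr(6) V(1) carr(3)])
    have "fD * W = W * fE"
    proof (rule eq_matI)
      fix i j assume "i < dim_row (W * fE)" "j < dim_col (W * fE)"
      then have ij: "i < n" "j < n" using carr by auto
      have "(D * W) $$ (i, j) = (W * E) $$ (i, j)" by (simp add: DW)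
      then have "complex_of_real (l ! i) * W $$ (i, j) = W $$ (i, j) * complex_of_real (\<mu> j)"
        using ij by (simp add: D_def E_def mat_diag_mult_left[OF carr(5)] mat_diag_mult_right[OF carr(5)])
      then have "W $$ (i, j) = 0 \<or> l ! i = \<mu> j" by (auto simp: mult.commute)
      then show "(fD * W) $$ (i, j) = (W * fE) $$ (i, j)"
        using ij by (auto simp: fD_def fE_def mat_diag_mult_left[OF carr(5)] mat_diag_mult_right[OF carr(5)])
    qed (use carr in auto)
    moreover have "W * mat_adjoint V = mat_adjoint U"
      unfolding W_def by (simp only: assoc[OF carr(6) V(1) carr(7)] VV' right_mult_one_mat[OF carr(6)])
    then have "U * (fD * W) * mat_adjoint V = U * fD * mat_adjoint U"
      by (simp only: assoc[OF U carr(2,5), symmetric] assoc[OF mult_carrier_mat[OF U carr(2)] carr(5,7)])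
    moreover have "U * W = V" unfolding W_def by (rule cancel(2)[OF V(1)])
    then have "U * (W * fE) = V * fE" by (simp only: assoc[OF U carr(5,4), symmetric])
    ultimately show ?thesis by (simp add: fE_def)
  qed
  show ?thesis
    unfolding mat_fun_def Let_def dim n_def[symmetric] fD_def[symmetric]
  proof (rule the_equality)
    show "\<exists>V \<mu>. V \<in> carrier_mat n n \<and> mat_adjoint V * V = 1\<^sub>m n \<and>
        A = V * mat_diag n (\<lambda>i. complex_of_real (\<mu> i)) * mat_adjoint V \<and>
        U * fD * mat_adjoint U = V * mat_diag n (\<lambda>i. complex_of_real (f (\<mu> i))) * mat_adjoint V"
      by (rule exI[of _ U], rule exI[of _ "\<lambda>i. l ! i"]) (use U UU in \<open>simp add: A D_def fD_def\<close>)
  qed (use unique in blast)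
qed

section \<open>Quadratic forms and comparison of eigenvalues\<close>

lemma append_vec_zero: "0\<^sub>v m @\<^sub>v 0\<^sub>v n = (0\<^sub>v (m + n) :: complex vec)"
  by (rule eq_vecI) auto

lemma inner_diff_left:
  assumes "(x :: complex vec) \<in> carrier_vec n" "y \<in> carrier_vec n" "z \<in> carrier_vec n"
  shows "(x - y) \<bullet>c z = x \<bullet>c z - y \<bullet>c z"
  using assms by (intro minus_scalar_prod_distrib[of _ n]) auto

lemma inner_diff_right:
  assumes "(x :: complex vec) \<in> carrier_vec n" "y \<in> carrier_vec n" "z \<in> carrier_vec n"
  shows "x \<bullet>c (y - z) = x \<bullet>c y - x \<bullet>c z"
proof -
  have "conjugate (y - z) = conjugate y - conjugate z" using assms by (intro eq_vecI) auto
  then show ?thesis using assms by (simp add: scalar_prod_minus_distrib[of _ n])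
qed

lemma Re_inner_self: "Re (x \<bullet>c x) = (\<Sum>i<dim_vec x. (cmod (x $ i))\<^sup>2)"
  unfolding inner_self by simp

lemma Re_inner_self_ge_0: "0 \<le> Re (x \<bullet>c x)"
  unfolding Re_inner_self by (intro sum_nonneg) auto

lemma Re_inner_self_pos:
  assumes "(x :: complex vec) \<in> carrier_vec n" "x \<noteq> 0\<^sub>v n"
  shows "0 < Re (x \<bullet>c x)"
proof -
  have "x \<bullet>c x \<noteq> 0" using conjugate_square_eq_0_vec[OF assms(1)] assms(2) by simp
  then have "Re (x \<bullet>c x) \<noteq> 0" unfolding inner_self by (metis Re_complex_of_real of_real_0)
  then show ?thesis using Re_inner_self_ge_0[of x] by simp
qed

text \<open>The coordinates of x in the eigenbasis are written as products with rows of the adjoint,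
  so that the vanishing of a coordinate is an equation of the kind that
  \<open>exists_common_zero\<close> solves.\<close>

lemma unitary_diag_quadratic:
  assumes "unitary_diag U l A" "length l = d" "x \<in> carrier_vec d"
  shows "Re ((A *\<^sub>v x) \<bullet>c x) = (\<Sum>i<d. l ! i * (cmod (row (mat_adjoint U) i \<bullet> x))\<^sup>2)"
    and "Re (x \<bullet>c x) = (\<Sum>i<d. (cmod (row (mat_adjoint U) i \<bullet> x))\<^sup>2)"
proof -
  define D where "D = mat_diag d (\<lambda>i. complex_of_real (l ! i))"
  have U: "U \<in> carrier_mat d d" and UU: "mat_adjoint U * U = 1\<^sub>m d" and A: "A = U * D * mat_adjoint U"
    using assms(1,2) by (auto simp: unitary_diag_def D_def)
  have D: "D \<in> carrier_mat d d" by (simp add: D_def)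
  define y where "y = mat_adjoint U *\<^sub>v x"
  have y: "y \<in> carrier_vec d" using mult_mat_vec_carrier[OF mat_adjoint_carrier[OF U] assms(3)] by (simp add: y_def)
  have yi: "y $ i = row (mat_adjoint U) i \<bullet> x" if "i < d" for i using that U by (simp add: y_def)
  have Dy: "(D *\<^sub>v y) $ i = complex_of_real (l ! i) * y $ i" if "i < d" for i
  proof -
    have "(D *\<^sub>v y) $ i = (\<Sum>j<d. D $$ (i, j) * y $ j)"
      using that y D by (simp add: scalar_prod_def atLeast0LessThan)
    also have "\<dots> = (\<Sum>j<d. if j = i then complex_of_real (l ! i) * y $ i else 0)"
      using that by (intro sum.cong) (auto simp: D_def mat_diag_def)
    finally show ?thesis using that by simp
  qed
  have "A *\<^sub>v x = U *\<^sub>v (D *\<^sub>v y)"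
    using assoc_mult_mat_vec[OF mult_carrier_mat[OF U D] mat_adjoint_carrier[OF U] assms(3)]
      assoc_mult_mat_vec[OF U D y] by (simp add: A y_def)
  then have "(A *\<^sub>v x) \<bullet>c x = (D *\<^sub>v y) \<bullet>c y"
    using inner_mat_adjoint[OF U mult_mat_vec_carrier[OF D y] assms(3)] by (simp add: y_def)
  also have "\<dots> = (\<Sum>i<d. complex_of_real (l ! i * (cmod (y $ i))\<^sup>2))"
    unfolding scalar_prod_def using y D
    by (auto simp: Dy atLeast0LessThan complex_norm_square simp del: of_real_power index_mult_mat_vec intro!: sum.cong)
  finally show "Re ((A *\<^sub>v x) \<bullet>c x) = (\<Sum>i<d. l ! i * (cmod (row (mat_adjoint U) i \<bullet> x))\<^sup>2)"
    using yi by simp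
  have "U *\<^sub>v y = x"
    using assoc_mult_mat_vec[OF U mat_adjoint_carrier[OF U] assms(3)] unitary_right_inverse[OF U UU] assms(3)
    by (simp add: y_def)
  then have "x \<bullet>c x = y \<bullet>c y" using inner_mat_adjoint[OF U y assms(3)] by (simp add: y_def)
  then show "Re (x \<bullet>c x) = (\<Sum>i<d. (cmod (row (mat_adjoint U) i \<bullet> x))\<^sup>2)"
    using y yi by (simp add: Re_inner_self)
qed

text \<open>A Courant-Fischer argument: fewer than \<open>d + e\<close> homogeneous linear equations in \<open>(x, y)\<close> force
  \<open>x\<close> into the span of the top eigenvectors of \<open>A\<close> and of the bottom eigenvectors of \<open>C\<close>. The
  auxiliary unknowns \<open>y\<close> allow constraints on \<open>x\<close> that are given implicitly.\<close>

lemma eigenvalue_comparison: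
  fixes A C :: "complex mat"
  assumes a: "unitary_diag U a A" "sorted_wrt (\<ge>) a" "length a = d"
    and c: "unitary_diag V c C" "sorted_wrt (\<ge>) c" "length c = d"
    and rs: "set rs \<subseteq> carrier_vec (d + e)" "length rs \<le> e + q"
    and cmp: "\<And>x y. x \<in> carrier_vec d \<Longrightarrow> y \<in> carrier_vec e \<Longrightarrow> x @\<^sub>v y \<noteq> 0\<^sub>v (d + e) \<Longrightarrow>
      (\<And>r. r \<in> set rs \<Longrightarrow> r \<bullet> (x @\<^sub>v y) = 0) \<Longrightarrow>
      x \<noteq> 0\<^sub>v d \<and> Re ((A *\<^sub>v x) \<bullet>c x) \<le> Re ((C *\<^sub>v x) \<bullet>c x)"
    and j: "q \<le> j" "j < d"
  shows "a ! j \<le> c ! (j - q)"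
proof -
  have U: "U \<in> carrier_mat d d" and V: "V \<in> carrier_mat d d"
    using a(1,3) c(1,3) by (auto simp: unitary_diag_def)
  define us where "us = map (row (mat_adjoint U)) [Suc j..<d] @ map (row (mat_adjoint V)) [0..<j - q]"
  have "row (mat_adjoint U) i \<in> carrier_vec d" "row (mat_adjoint V) i \<in> carrier_vec d" for i
    by (rule carrier_vecI, simp add: carrier_matD[OF U] carrier_matD[OF V])+
  then have us: "set us \<subseteq> carrier_vec d" by (auto simp: us_def)
  define ws where "ws = map (\<lambda>u. u @\<^sub>v 0\<^sub>v e) us @ rs"
  have "set ws \<subseteq> carrier_vec (d + e)" using us rs(1) by (auto simp: ws_def)
  \<comment> \<open>The count is tight: d - 1 - j equations from U, j - q from V and at most e + q
    from \<open>rs\<close> make d + e - 1, one fewer than the unknowns.\<close>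
  moreover have "length ws < d + e" using rs(2) j by (simp add: ws_def us_def)
  ultimately obtain z where z: "z \<in> carrier_vec (d + e)" "z \<noteq> 0\<^sub>v (d + e)" "\<forall>w \<in> set ws. w \<bullet> z = 0"
    using exists_common_zero by blast
  define x y where "x = vec_first z d" and "y = vec_last z e"
  have xy: "x \<in> carrier_vec d" "y \<in> carrier_vec e" "z = x @\<^sub>v y" using z(1) by (auto simp: x_def y_def)
  have x: "x \<noteq> 0\<^sub>v d" and le: "Re ((A *\<^sub>v x) \<bullet>c x) \<le> Re ((C *\<^sub>v x) \<bullet>c x)"
    using cmp[OF xy(1,2)] z(2,3) by (auto simp: xy(3) ws_def)
  have ux: "u \<bullet> x = 0" if "u \<in> set us" for u
  proof -
    have "(u @\<^sub>v 0\<^sub>v e) \<bullet> z = 0" using z(3) that by (simp add: ws_def)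
    moreover have "(u @\<^sub>v 0\<^sub>v e) \<bullet> z = u \<bullet> x + 0\<^sub>v e \<bullet> y"
      unfolding xy(3) using us that xy by (intro scalar_prod_append) auto
    ultimately show ?thesis using xy(2) by simp
  qed
  have "a ! j * Re (x \<bullet>c x) = (\<Sum>i<d. a ! j * (cmod (row (mat_adjoint U) i \<bullet> x))\<^sup>2)"
    using unitary_diag_quadratic(2)[OF a(1,3) xy(1)] by (simp add: sum_distrib_left)
  also have "\<dots> \<le> (\<Sum>i<d. a ! i * (cmod (row (mat_adjoint U) i \<bullet> x))\<^sup>2)"
  proof (rule sum_mono)
    fix i assume "i \<in> {..<d}"
    then have i: "i < d" by simp
    show "a ! j * (cmod (row (mat_adjoint U) i \<bullet> x))\<^sup>2 \<le> a ! i * (cmod (row (mat_adjoint U) i \<bullet> x))\<^sup>2"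
    proof (cases "i \<le> j")
      case True
      then show ?thesis using sorted_desc_nth[OF a(2), of i j] a(3) j by (intro mult_right_mono) auto
    next
      case False
      then have "row (mat_adjoint U) i \<bullet> x = 0" using i by (intro ux) (auto simp: us_def)
      then show ?thesis by simp
    qed
  qed
  also have "\<dots> = Re ((A *\<^sub>v x) \<bullet>c x)" by (rule unitary_diag_quadratic(1)[OF a(1,3) xy(1), symmetric])
  also have "\<dots> \<le> Re ((C *\<^sub>v x) \<bullet>c x)" by (rule le)
  also have "\<dots> = (\<Sum>i<d. c ! i * (cmod (row (mat_adjoint V) i \<bullet> x))\<^sup>2)"
    by (rule unitary_diag_quadratic(1)[OF c(1,3) xy(1)])
  also have "\<dots> \<le> (\<Sum>i<d. c ! (j - q) * (cmod (row (mat_adjoint V) i \<bullet> x))\<^sup>2)"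
  proof (rule sum_mono)
    fix i assume "i \<in> {..<d}"
    then have i: "i < d" by simp
    show "c ! i * (cmod (row (mat_adjoint V) i \<bullet> x))\<^sup>2 \<le> c ! (j - q) * (cmod (row (mat_adjoint V) i \<bullet> x))\<^sup>2"
    proof (cases "j - q \<le> i")
      case True
      then show ?thesis using sorted_desc_nth[OF c(2), of "j - q" i] c(3) i by (intro mult_right_mono) auto
    next
      case False
      then have "row (mat_adjoint V) i \<bullet> x = 0" using i by (intro ux) (auto simp: us_def)
      then show ?thesis by simp
    qed
  qed
  also have "\<dots> = c ! (j - q) * Re (x \<bullet>c x)"
    using unitary_diag_quadratic(2)[OF c(1,3) xy(1)] by (simp add: sum_distrib_left)
  finally show ?thesis using Re_inner_self_pos[OF xy(1) x] by simp
qed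

lemma unitary_diag_nonneg:
  assumes "unitary_diag U l A" "length l = d" "i < d"
    and psd: "\<And>x. x \<in> carrier_vec d \<Longrightarrow> 0 \<le> Re ((A *\<^sub>v x) \<bullet>c x)"
  shows "0 \<le> l ! i"
proof -
  have U: "U \<in> carrier_mat d d" and UU: "mat_adjoint U * U = 1\<^sub>m d"
    using assms(1,2) by (auto simp: unitary_diag_def)
  define x where "x = col U i"
  have x: "x \<in> carrier_vec d" using U by (auto simp: x_def)
  have "row (mat_adjoint U) j \<bullet> x = (if j = i then 1 else 0)" if "j < d" for j
  proof -
    have "row (mat_adjoint U) j \<bullet> x = (mat_adjoint U * U) $$ (j, i)" using that U assms(3) by (simp add: x_def)
    then show ?thesis using that assms(3) by (simp add: UU)
  qed
  then have "Re ((A *\<^sub>v x) \<bullet>c x) = (\<Sum>j<d. l ! j * (if j = i then 1 else 0))"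
    unfolding unitary_diag_quadratic(1)[OF assms(1,2) x] by (intro sum.cong) auto
  also have "\<dots> = l ! i" using assms(3) by (simp add: if_distrib sum.delta cong: if_cong)
  finally show ?thesis using psd[OF x] by simp
qed

section \<open>Dual frames\<close>

lemma analysis_op_carrier [simp]: "analysis_op d G \<in> carrier_mat (length G) d"
  by (auto simp: analysis_op_def)

lemma mat_adjoint_analysis_op:
  assumes "set G \<subseteq> carrier_vec d"
  shows "mat_adjoint (analysis_op d G) = mat_of_cols d G"
proof (rule eq_matI)
  fix i j assume "i < dim_row (mat_of_cols d G)" "j < dim_col (mat_of_cols d G)"
  then have ij: "i < d" "j < length G" by auto
  then have "dim_vec (G ! j) = d" using subsetD[OF assms nth_mem[OF ij(2)]] by simp
  then show "mat_adjoint (analysis_op d G) $$ (i, j) = mat_of_cols d G $$ (i, j)"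
    using ij by (simp add: analysis_op_def mat_of_cols_def mat_of_rows_def)
qed (auto simp: analysis_op_def)

text \<open>The vectors span, so x is the adjoint of the analysis operator applied to some
  coefficient vector; then the product of x with itself equals that of the coefficients with the
  image of x, which is zero.\<close>

lemma frames_injective:
  assumes F: "F \<in> frames n d" and x: "x \<in> carrier_vec d" "analysis_op d F *\<^sub>v x = 0\<^sub>v n"
  shows "x = 0\<^sub>v d"
proof -
  interpret vec_space "TYPE(complex)" d .
  have len: "length F = n" and Fc: "set F \<subseteq> carrier_vec d" and sp: "span (set F) = carrier_vec d"
    using F by (auto simp: frames_def)
  have T: "analysis_op d F \<in> carrier_mat n d" using analysis_op_carrier[of d F] len by simp
  have "x \<in> span_list F" using span_list_as_span[OF Fc] sp x(1) by simp
  then obtain c where "x = lincomb_list c F" by (rule in_span_listE)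
  moreover have "dim_vec w = d" if "w \<in> set F" for w using subsetD[OF Fc that] by simp
  ultimately have xc: "mat_adjoint (analysis_op d F) *\<^sub>v vec n c = x"
    using lincomb_list_as_mat_mult[of F c] len by (simp add: mat_adjoint_analysis_op[OF Fc])
  have "x \<bullet>c x = vec n c \<bullet>c (analysis_op d F *\<^sub>v x)"
    by (rule inner_mat_adjoint[OF mat_adjoint_carrier[OF T] vec_carrier[of n c] x(1),
          unfolded mat_adjoint_adjoint xc])
  then have "x \<bullet>c x = 0" using x(2) by simp
  then show ?thesis using conjugate_square_eq_0_vec[OF x(1)] by simp
qed

text \<open>The duality identity applied to x exhibits x as a combination of G with coefficients
  \<open>T *\<^sub>v x\<close>, so spanning comes for free when a dual is constructed.\<close>

lemma framesI:
  assumes G: "length G = n" "set G \<subseteq> carrier_vec d" and T: "T \<in> carrier_mat n d"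
    and dual: "mat_adjoint (analysis_op d G) * T = 1\<^sub>m d"
  shows "G \<in> frames n d"
proof -
  interpret vec_space "TYPE(complex)" d .
  have "x \<in> span (set G)" if x: "x \<in> carrier_vec d" for x
  proof -
    have "x = (mat_of_cols d G * T) *\<^sub>v x" using dual x by (simp add: mat_adjoint_analysis_op[OF G(2)])
    also have "\<dots> = mat_of_cols d G *\<^sub>v (T *\<^sub>v x)"
      using G T x by (intro assoc_mult_mat_vec[of _ d n _ d]) auto
    also have "T *\<^sub>v x = vec (length G) (\<lambda>i. (T *\<^sub>v x) $ i)"
      using T G by (intro eq_vecI) auto
    also have "mat_of_cols d G *\<^sub>v \<dots> = lincomb_list (\<lambda>i. (T *\<^sub>v x) $ i) G"
      using G(2) by (intro lincomb_list_as_mat_mult[symmetric]) auto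
    finally have "x \<in> span_list G" by (intro in_span_listI) auto
    then show ?thesis using span_list_as_span[OF G(2)] by simp
  qed
  moreover have "span (set G) \<subseteq> carrier_vec d" using G(2) by auto
  ultimately show ?thesis using G by (auto simp: frames_def)
qed

lemma frame_op_inverse:
  assumes F: "F \<in> frames n d"
  defines "Si \<equiv> the (mat_inverse (frame_op d F))"
  shows "Si \<in> carrier_mat d d" "frame_op d F * Si = 1\<^sub>m d" "Si * frame_op d F = 1\<^sub>m d"
    "mat_adjoint Si = Si"
proof -
  have T: "analysis_op d F \<in> carrier_mat n d"
    using F analysis_op_carrier[of d F] by (simp add: frames_def)
  have S: "frame_op d F \<in> carrier_mat d d"
    unfolding frame_op_def by (rule mult_carrier_mat[OF mat_adjoint_carrier[OF T] T])
  have "x = 0\<^sub>v d" if x: "x \<in> carrier_vec d" "frame_op d F *\<^sub>v x = 0\<^sub>v d" for x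
  proof -
    have Tx: "analysis_op d F *\<^sub>v x \<in> carrier_vec n" by (rule mult_mat_vec_carrier[OF T x(1)])
    have "mat_adjoint (analysis_op d F) *\<^sub>v (analysis_op d F *\<^sub>v x) = 0\<^sub>v d"
      using assoc_mult_mat_vec[OF mat_adjoint_carrier[OF T] T x(1)] x(2) by (simp add: frame_op_def)
    then have "(analysis_op d F *\<^sub>v x) \<bullet>c (analysis_op d F *\<^sub>v x) = 0"
      using inner_mat_adjoint[OF T x(1) Tx] x(1) by simp
    then have "analysis_op d F *\<^sub>v x = 0\<^sub>v n" using conjugate_square_eq_0_vec[OF Tx] by simp
    then show ?thesis by (rule frames_injective[OF F x(1)])
  qed
  then have "det (frame_op d F) \<noteq> 0" using det_0_iff_vec_prod_zero[OF S] by blast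
  then have "frame_op d F \<in> Units (ring_mat TYPE(complex) d ())" by (rule det_non_zero_imp_unit[OF S])
  then have "mat_inverse (frame_op d F) \<noteq> None" using mat_inverse(1)[OF S, where b = "()"] by blast
  then have "mat_inverse (frame_op d F) = Some Si" by (simp add: Si_def)
  then have inv: "frame_op d F * Si = 1\<^sub>m d \<and> Si * frame_op d F = 1\<^sub>m d \<and> Si \<in> carrier_mat d d"
    by (rule mat_inverse(2)[OF S])
  then show Si: "Si \<in> carrier_mat d d" and SSi: "frame_op d F * Si = 1\<^sub>m d"
    and "Si * frame_op d F = 1\<^sub>m d" by auto
  have SS: "mat_adjoint (frame_op d F) = frame_op d F"
    unfolding frame_op_def by (simp add: mat_adjoint_mult[OF mat_adjoint_carrier[OF T] T])
  have "mat_adjoint Si * frame_op d F = mat_adjoint (frame_op d F * Si)"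
    by (simp add: mat_adjoint_mult[OF S Si] SS)
  also have "\<dots> = 1\<^sub>m d" by (simp add: SSi)
  finally have "mat_adjoint Si * frame_op d F = 1\<^sub>m d" .
  then have "mat_adjoint Si * (frame_op d F * Si) = Si"
    using assoc_mult_mat[OF mat_adjoint_carrier[OF Si] S Si] Si by simp
  then show "mat_adjoint Si = Si"
    using right_mult_one_mat[OF mat_adjoint_carrier[OF Si]] by (simp add: SSi)
qed

lemma frame_op_inner:
  assumes "T = analysis_op d G" "length G = n" "x \<in> carrier_vec d"
  shows "(frame_op d G *\<^sub>v x) \<bullet>c x = (T *\<^sub>v x) \<bullet>c (T *\<^sub>v x)"
proof -
  have T: "T \<in> carrier_mat n d" using assms analysis_op_carrier[of d G] by simp
  have "frame_op d G *\<^sub>v x = mat_adjoint T *\<^sub>v (T *\<^sub>v x)"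
    using assoc_mult_mat_vec[OF mat_adjoint_carrier[OF T] T assms(3)] by (simp add: frame_op_def assms(1))
  then show ?thesis
    using inner_mat_adjoint[OF mat_adjoint_carrier[OF T] mult_mat_vec_carrier[OF T assms(3)] assms(3)] by simp
qed

lemma frame_op_hermitian:
  "frame_op d G \<in> carrier_mat d d" "mat_adjoint (frame_op d G) = frame_op d G"
proof -
  note T = analysis_op_carrier[of d G]
  show "frame_op d G \<in> carrier_mat d d"
    unfolding frame_op_def by (rule mult_carrier_mat[OF mat_adjoint_carrier[OF T] T])
  show "mat_adjoint (frame_op d G) = frame_op d G"
    unfolding frame_op_def by (simp add: mat_adjoint_mult[OF mat_adjoint_carrier[OF T] T])
qed

section \<open>Spectral bounds for dual frames\<close>

text \<open>The vector a, the image of x under the analysis operator of the canonical dual, is the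
  orthogonal projection of g onto the range of T: the adjoint of T sends both to x. Pythagoras gives
  the first inequality, and if g lies in the range of T then g = a. The squared norm of a is the
  form of \<open>Si\<close> at x, hence the third claim.\<close>

lemma dual_frame_quadratic:
  assumes F: "F \<in> frames n d" and G: "G \<in> dual_frames n d F" and x: "x \<in> carrier_vec d"
  defines "Si \<equiv> the (mat_inverse (frame_op d F))"
  shows "Re ((Si *\<^sub>v x) \<bullet>c x) \<le> Re ((frame_op d G *\<^sub>v x) \<bullet>c x)"
    and "y \<in> carrier_vec d \<Longrightarrow> analysis_op d G *\<^sub>v x = analysis_op d F *\<^sub>v y \<Longrightarrow>
      y = Si *\<^sub>v x \<and> (frame_op d G *\<^sub>v x) \<bullet>c x = (Si *\<^sub>v x) \<bullet>c x"
    and "0 \<le> Re ((Si *\<^sub>v x) \<bullet>c x)"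
proof -
  define T where "T = analysis_op d F"
  define K where "K = analysis_op d G"
  have len: "length F = n" "length G = n" and dual: "mat_adjoint K * T = 1\<^sub>m d"
    using F G by (auto simp: frames_def dual_frames_def T_def K_def)
  have T: "T \<in> carrier_mat n d" and K: "K \<in> carrier_mat n d"
    using analysis_op_carrier[of d F] analysis_op_carrier[of d G] len by (auto simp: T_def K_def)
  note Ta = mat_adjoint_carrier[OF T] and Ka = mat_adjoint_carrier[OF K]
  have Si: "Si \<in> carrier_mat d d" and SSi: "frame_op d F * Si = 1\<^sub>m d" "Si * frame_op d F = 1\<^sub>m d"
    and Sih: "mat_adjoint Si = Si"
    using frame_op_inverse[OF F] by (simp_all add: Si_def)
  have S: "frame_op d F \<in> carrier_mat d d" by (rule frame_op_hermitian)
  have "mat_adjoint (mat_adjoint K * T) = mat_adjoint T * K"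
    using mat_adjoint_mult[OF Ka T] by simp
  then have TK: "mat_adjoint T * K = 1\<^sub>m d" by (simp add: dual)
  have Tg: "mat_adjoint T *\<^sub>v (K *\<^sub>v x) = x"
    using assoc_mult_mat_vec[OF Ta K x] x by (simp add: TK)
  have Ty: "mat_adjoint T *\<^sub>v (T *\<^sub>v z) = frame_op d F *\<^sub>v z" if "z \<in> carrier_vec d" for z
    using assoc_mult_mat_vec[OF Ta T that] by (simp add: frame_op_def T_def)
  define z where "z = Si *\<^sub>v x"
  have z: "z \<in> carrier_vec d" using mult_mat_vec_carrier[OF Si x] by (simp add: z_def)
  have Sz: "frame_op d F *\<^sub>v z = x" using assoc_mult_mat_vec[OF S Si x] x by (simp add: z_def SSi)
  define g a where "g = K *\<^sub>v x" and "a = T *\<^sub>v z"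
  have ga: "g \<in> carrier_vec n" "a \<in> carrier_vec n"
    using mult_mat_vec_carrier[OF K x] mult_mat_vec_carrier[OF T z] by (auto simp: g_def a_def)
  have aa: "a \<bullet>c a = z \<bullet>c x"
    using inner_mat_adjoint[OF T z ga(2)] Ty[OF z] Sz by (simp add: a_def)
  have ag: "a \<bullet>c g = z \<bullet>c x"
    using inner_mat_adjoint[OF T z ga(1)] Tg by (simp add: a_def g_def)
  have "Re (g \<bullet>c a) = Re (a \<bullet>c a)"
    using inner_cnj[OF ga(1,2)] ag aa by simp
  moreover have "(g - a) \<bullet>c (g - a) = g \<bullet>c g - g \<bullet>c a - (a \<bullet>c g - a \<bullet>c a)"
    using ga by (simp add: inner_diff_left[of _ n] inner_diff_right[of _ n])
  ultimately have "Re ((g - a) \<bullet>c (g - a)) = Re (g \<bullet>c g) - Re (a \<bullet>c a)"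
    by (simp add: ag aa)
  then have "Re (a \<bullet>c a) \<le> Re (g \<bullet>c g)" using Re_inner_self_ge_0[of "g - a"] by simp
  then show "Re ((Si *\<^sub>v x) \<bullet>c x) \<le> Re ((frame_op d G *\<^sub>v x) \<bullet>c x)"
    using frame_op_inner[OF K_def len(2) x] aa by (simp add: z_def g_def)
  show "0 \<le> Re ((Si *\<^sub>v x) \<bullet>c x)" using aa Re_inner_self_ge_0[of a] by (simp add: z_def)
  show "y = Si *\<^sub>v x \<and> (frame_op d G *\<^sub>v x) \<bullet>c x = (Si *\<^sub>v x) \<bullet>c x"
    if y: "y \<in> carrier_vec d" and eq: "analysis_op d G *\<^sub>v x = analysis_op d F *\<^sub>v y"
  proof -
    have gy: "g = T *\<^sub>v y" using eq by (simp add: g_def K_def T_def)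
    have "frame_op d F *\<^sub>v y = x" using Ty[OF y] Tg gy by (simp add: g_def)
    then have yz: "y = z" using assoc_mult_mat_vec[OF Si S y] y by (simp add: SSi z_def)
    then have "g = a" by (simp add: gy a_def)
    then show ?thesis using yz frame_op_inner[OF K_def len(2) x] aa by (simp add: z_def g_def)
  qed
qed

text \<open>The second inequality is Cauchy interlacing for the perturbation \<open>S\<^sub>G - S\<^sub>F\<inverse>\<close>, which has
  rank at most \<open>n - d\<close>. Instead of bounding the rank, the equations
  \<open>T\<^sub>G x = T\<^sub>F y\<close> in the unknowns \<open>(x, y)\<close> single out the vectors \<open>x\<close> on which both quadratic
  forms agree.\<close>

lemma dual_frame_eigs:
  assumes F: "F \<in> frames n d" and G: "G \<in> dual_frames n d F" and "d \<le> n" and j: "j < d"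
  defines "l \<equiv> eigs (the (mat_inverse (frame_op d F)))" and "\<mu> \<equiv> eigs (frame_op d G)"
  shows "l ! j \<le> \<mu> ! j" and "n - d \<le> j \<Longrightarrow> \<mu> ! j \<le> l ! (j - (n - d))"
proof -
  define Si where "Si = the (mat_inverse (frame_op d F))"
  note Si = frame_op_inverse[OF F, folded Si_def]
  note quad = dual_frame_quadratic[OF F G, folded Si_def]
  obtain U where U: "unitary_diag U l Si" "sorted_wrt (\<ge>) l" "length l = d"
    using hermitian_eigs[OF Si(1,4)] unfolding l_def Si_def[symmetric] by blast
  obtain V where V: "unitary_diag V \<mu> (frame_op d G)" "sorted_wrt (\<ge>) \<mu>" "length \<mu> = d"
    using hermitian_eigs[OF frame_op_hermitian] unfolding \<mu>_def by blast
  \<comment> \<open>Without equations and with an empty y, the comparison is plain monotonicity of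
    eigenvalues.\<close>
  have "l ! j \<le> \<mu> ! (j - 0)"
  proof (rule eigenvalue_comparison[OF U V, of "[]" 0 0])
    fix x y :: "complex vec"
    assume xy: "x \<in> carrier_vec d" "y \<in> carrier_vec 0" "x @\<^sub>v y \<noteq> 0\<^sub>v (d + 0)"
    then have "x \<noteq> 0\<^sub>v d" using append_vec_zero[of d 0] by auto
    then show "x \<noteq> 0\<^sub>v d \<and> Re ((Si *\<^sub>v x) \<bullet>c x) \<le> Re ((frame_op d G *\<^sub>v x) \<bullet>c x)"
      using quad(1)[OF xy(1)] by simp
  qed (use j in auto)
  then show "l ! j \<le> \<mu> ! j" by simp
  define T K where "T = analysis_op d F" and "K = analysis_op d G"
  have len: "length F = n" "length G = n" using F G by (auto simp: frames_def dual_frames_def)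
  have T: "T \<in> carrier_mat n d" and K: "K \<in> carrier_mat n d"
    using analysis_op_carrier[of d F] analysis_op_carrier[of d G] len by (auto simp: T_def K_def)
  define rs where "rs = map (\<lambda>i. row K i @\<^sub>v - row T i) [0..<n]"
  have rows: "row K i \<in> carrier_vec d" "row T i \<in> carrier_vec d" for i
    by (rule carrier_vecI, simp add: carrier_matD[OF K] carrier_matD[OF T])+
  assume nd: "n - d \<le> j"
  show "\<mu> ! j \<le> l ! (j - (n - d))"
  \<comment> \<open>There are d auxiliary unknowns and n = d + (n - d) equations, so the index shift
    q is n - d.\<close>
  proof (rule eigenvalue_comparison[OF V U, of rs d "n - d"])
    show "set rs \<subseteq> carrier_vec (d + d)" using rows by (auto simp: rs_def)
    show "length rs \<le> d + (n - d)" by (simp add: rs_def)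
    fix x y :: "complex vec"
    assume xy: "x \<in> carrier_vec d" "y \<in> carrier_vec d" "x @\<^sub>v y \<noteq> 0\<^sub>v (d + d)"
      and 0: "\<And>r. r \<in> set rs \<Longrightarrow> r \<bullet> (x @\<^sub>v y) = 0"
    have "K *\<^sub>v x = T *\<^sub>v y"
    proof (rule eq_vecI)
      fix i assume "i < dim_vec (T *\<^sub>v y)"
      then have i: "i < n" using T by simp
      then have "(row K i @\<^sub>v - row T i) \<bullet> (x @\<^sub>v y) = 0" by (intro 0) (simp add: rs_def)
      moreover have "(row K i @\<^sub>v - row T i) \<bullet> (x @\<^sub>v y) = row K i \<bullet> x + (- row T i) \<bullet> y"
        using rows xy by (intro scalar_prod_append) auto
      ultimately have "row K i \<bullet> x = row T i \<bullet> y"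
        using scalar_prod_uminus_left[of y "row T i"] carrier_vecD[OF rows(2)] carrier_vecD[OF xy(2)] by simp
      then show "(K *\<^sub>v x) $ i = (T *\<^sub>v y) $ i" using i K T by simp
    qed (use K T in auto)
    then have *: "y = Si *\<^sub>v x \<and> (frame_op d G *\<^sub>v x) \<bullet>c x = (Si *\<^sub>v x) \<bullet>c x"
      using quad(2)[OF xy(1,2)] by (simp add: K_def T_def)
    \<comment> \<open>Only the pair is known to be nonzero; since y is determined by x, the
      auxiliary unknowns cannot carry a solution on their own.\<close>
    moreover have "x \<noteq> 0\<^sub>v d"
    proof
      assume "x = 0\<^sub>v d"
      then have "y = 0\<^sub>v d" using * Si(1) by auto
      then show False using xy(3) \<open>x = 0\<^sub>v d\<close> by (simp add: append_vec_zero)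
    qed
    ultimately show "x \<noteq> 0\<^sub>v d \<and> Re ((frame_op d G *\<^sub>v x) \<bullet>c x) \<le> Re ((Si *\<^sub>v x) \<bullet>c x)" by simp
  qed (use nd j in auto)
qed

section \<open>Dual frames with prescribed spectrum\<close>

text \<open>Only the last d - k diagonal entries can be nonzero, so p >= d - k columns suffice for a
  square root: M is the diagonal of square roots moved k columns to the left.\<close>

lemma exists_factorization:
  assumes U: "U \<in> carrier_mat d d" and b: "\<And>i. i < d \<Longrightarrow> 0 \<le> b i" "\<And>i. i < k \<Longrightarrow> b i = 0" and "d \<le> k + p"
  shows "\<exists>V. V \<in> carrier_mat d p \<and>
    V * mat_adjoint V = U * mat_diag d (\<lambda>i. complex_of_real (b i)) * mat_adjoint U"
proof -
  define M where "M = mat d p (\<lambda>(i, j). if i = j + k then complex_of_real (sqrt (b i)) else 0)"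
  have M: "M \<in> carrier_mat d p" by (simp add: M_def)
  have "M * mat_adjoint M = mat_diag d (\<lambda>i. complex_of_real (b i))"
  proof (rule eq_matI)
    fix i j assume "i < dim_row (mat_diag d (\<lambda>i. complex_of_real (b i)))"
      "j < dim_col (mat_diag d (\<lambda>i. complex_of_real (b i)))"
    then have ij: "i < d" "j < d" by (auto simp: mat_diag_def)
    have "(M * mat_adjoint M) $$ (i, j) = (\<Sum>q<p. M $$ (i, q) * cnj (M $$ (j, q)))"
      using ij M by (simp add: scalar_prod_def atLeast0LessThan)
    \<comment> \<open>For i < k the truncated difference i - k is 0, a legitimate column; the inner
      test \<open>k \<le> i\<close> discards it, which agrees with b i = 0.\<close>
    also have "\<dots> = (\<Sum>q<p. if q = i - k then (if i = j \<and> k \<le> i then complex_of_real (b i) else 0) else 0)"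
    proof (rule sum.cong)
      fix q assume "q \<in> {..<p}"
      then have q: "q < p" by simp
      have "complex_of_real (sqrt (b i)) * complex_of_real (sqrt (b i)) = complex_of_real (b i)"
        using b(1)[OF ij(1)] by (simp flip: of_real_mult)
      then show "M $$ (i, q) * cnj (M $$ (j, q)) =
          (if q = i - k then (if i = j \<and> k \<le> i then complex_of_real (b i) else 0) else 0)"
        using ij q by (auto simp: M_def)
    qed simp
    also have "\<dots> = (if i = j then complex_of_real (b i) else 0)"
      using ij \<open>d \<le> k + p\<close> b(2)[of i] by auto
    finally show "(M * mat_adjoint M) $$ (i, j) = mat_diag d (\<lambda>i. complex_of_real (b i)) $$ (i, j)"
      using ij by (simp add: mat_diag_def)
  qed (use M in \<open>auto simp: mat_diag_def\<close>)
  then have "(U * M) * mat_adjoint (U * M) = U * mat_diag d (\<lambda>i. complex_of_real (b i)) * mat_adjoint U"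
    unfolding mat_adjoint_mult[OF U M]
    using assoc_mult_mat[OF mult_carrier_mat[OF U M] mat_adjoint_carrier[OF M] mat_adjoint_carrier[OF U]]
      assoc_mult_mat[OF U M mat_adjoint_carrier[OF M]] by simp
  then show ?thesis using mult_carrier_mat[OF U M] by blast
qed

text \<open>The columns of P form the canonical dual. Adding \<open>V * mat_adjoint Z\<close>, where
  Z has orthonormal columns orthogonal to the range of T, preserves duality and kills the cross
  terms of the frame operator. There is room for n - d such columns, which fixes the width of
  V.\<close>

lemma exists_dual_frame:
  assumes F: "F \<in> frames n d" and V: "V \<in> carrier_mat d (n - d)" and "d \<le> n"
  defines "Si \<equiv> the (mat_inverse (frame_op d F))"
  shows "\<exists>G \<in> dual_frames n d F. frame_op d G = Si + V * mat_adjoint V"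
proof -
  define T where "T = analysis_op d F"
  define p where "p = n - d"
  have len: "length F = n" using F by (auto simp: frames_def)
  have T: "T \<in> carrier_mat n d" using analysis_op_carrier[of d F] len by (auto simp: T_def)
  have V: "V \<in> carrier_mat d p" using V by (simp add: p_def)
  have Si: "Si \<in> carrier_mat d d" and SSi: "mat_adjoint T * T * Si = 1\<^sub>m d" "Si * (mat_adjoint T * T) = 1\<^sub>m d"
    and Sih: "mat_adjoint Si = Si"
    using frame_op_inverse[OF F] by (simp_all add: Si_def frame_op_def T_def)
  have "set (cols T) \<subseteq> carrier_vec n" "length (cols T) + p \<le> n"
    using T \<open>d \<le> n\<close> cols_dim[of T] by (auto simp: p_def)
  from exists_orthonormal_perp[OF this] obtain zs
    where zs: "orthonormal n zs" "length zs = p" "\<forall>z \<in> set zs. \<forall>c \<in> set (cols T). z \<bullet>c c = 0" by blast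
  define Z where "Z = mat_of_cols n zs"
  have Z: "Z \<in> carrier_mat n p" using zs(2) by (auto simp: Z_def)
  have ZZ: "mat_adjoint Z * Z = 1\<^sub>m p" using orthonormal_adjoint_mult[OF zs(1)] zs(2) by (simp add: Z_def)
  note Ta = mat_adjoint_carrier[OF T] and Za = mat_adjoint_carrier[OF Z] and Va = mat_adjoint_carrier[OF V]
  have TZ: "mat_adjoint T * Z = 0\<^sub>m d p"
  proof (rule eq_matI)
    fix i j assume "i < dim_row (0\<^sub>m d p)" "j < dim_col (0\<^sub>m d p)"
    then have ij: "i < d" "j < p" by auto
    have zj: "zs ! j \<in> carrier_vec n" "zs ! j \<in> set zs" "col Z j = zs ! j"
      using ij zs(2) orthonormal_nth[OF zs(1), of j] by (auto simp: Z_def)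
    have "(mat_adjoint T * Z) $$ (i, j) = (mat_adjoint T *\<^sub>v col Z j) $ i" using ij T Z by simp
    also have "\<dots> = zs ! j \<bullet>c col T i"
      using mat_adjoint_mult_vec_index[OF T zj(1) ij(1)] by (simp only: zj(3))
    also have "\<dots> = 0"
      using zs(3) zj(2) nth_mem[of i "cols T"] cols_nth[of i T] ij T by auto
    finally show "(mat_adjoint T * Z) $$ (i, j) = 0\<^sub>m d p $$ (i, j)" using ij by simp
  qed (use T Z in auto)
  have "mat_adjoint (mat_adjoint T * Z) = mat_adjoint Z * T" using mat_adjoint_mult[OF Ta Z] by simp
  then have ZT: "mat_adjoint Z * T = 0\<^sub>m p d" by (simp add: TZ)
  define P where "P = Si * mat_adjoint T"
  define W where "W = V * mat_adjoint Z"
  have P: "P \<in> carrier_mat d n" and W: "W \<in> carrier_mat d n"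
    using mult_carrier_mat[OF Si Ta] mult_carrier_mat[OF V Za] by (auto simp: P_def W_def)
  note Pa = mat_adjoint_carrier[OF P] and Wa = mat_adjoint_carrier[OF W]
  have PT: "P * T = 1\<^sub>m d" using assoc_mult_mat[OF Si Ta T] SSi by (simp add: P_def)
  have WT: "W * T = 0\<^sub>m d d"
    using assoc_mult_mat[OF V Za T] V by (simp add: W_def ZT)
  have Pad: "mat_adjoint P = T * Si" using mat_adjoint_mult[OF Si Ta] Sih by (simp add: P_def)
  have PP: "P * mat_adjoint P = Si"
    using assoc_mult_mat[OF P T Si] Si by (simp add: Pad PT)
  have WP: "W * mat_adjoint P = 0\<^sub>m d d"
    using assoc_mult_mat[OF W T Si] Si by (simp add: Pad WT)
  have "mat_adjoint (W * mat_adjoint P) = P * mat_adjoint W" using mat_adjoint_mult[OF W Pa] by simp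
  then have PW: "P * mat_adjoint W = 0\<^sub>m d d" by (simp add: WP)
  have "W * mat_adjoint W = V * mat_adjoint Z * (Z * mat_adjoint V)"
    using mat_adjoint_mult[OF V Za] by (simp add: W_def)
  also have "\<dots> = V * (mat_adjoint Z * (Z * mat_adjoint V))"
    by (rule assoc_mult_mat[OF V Za mult_carrier_mat[OF Z Va]])
  also have "mat_adjoint Z * (Z * mat_adjoint V) = mat_adjoint V"
    using assoc_mult_mat[OF Za Z Va] left_mult_one_mat[OF Va] by (simp add: ZZ)
  finally have WW: "W * mat_adjoint W = V * mat_adjoint V" .
  define Q where "Q = P + W"
  have Q: "Q \<in> carrier_mat d n" using P W by (simp add: Q_def)
  have QT: "Q * T = 1\<^sub>m d" unfolding Q_def add_mult_distrib_mat[OF P W T] PT WT by simp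
  have "Q * mat_adjoint Q = (P + W) * mat_adjoint P + (P + W) * mat_adjoint W"
    unfolding Q_def mat_adjoint_add[OF P W]
    by (rule mult_add_distrib_mat[OF add_carrier_mat[OF W] Pa Wa])
  also have "\<dots> = (Si + 0\<^sub>m d d) + (0\<^sub>m d d + V * mat_adjoint V)"
    unfolding add_mult_distrib_mat[OF P W Pa] add_mult_distrib_mat[OF P W Wa] PP WP PW WW ..
  also have "\<dots> = Si + V * mat_adjoint V"
    using Si mult_carrier_mat[OF V Va] by simp
  finally have QQ: "Q * mat_adjoint Q = Si + V * mat_adjoint V" .
  define G where "G = cols Q"
  have Gl: "length G = n" and Gc: "set G \<subseteq> carrier_vec d" using Q cols_dim[of Q] by (auto simp: G_def)
  have GQ: "mat_adjoint (analysis_op d G) = Q"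
    unfolding mat_adjoint_analysis_op[OF Gc] using mat_of_cols_cols[of Q] Q by (simp add: G_def)
  then have GQ': "analysis_op d G = mat_adjoint Q" using mat_adjoint_adjoint[of "analysis_op d G"] by simp
  have "G \<in> frames n d" by (rule framesI[OF Gl Gc T]) (simp add: GQ QT)
  then have "G \<in> dual_frames n d F" using QT by (simp add: dual_frames_def GQ T_def)
  moreover have "frame_op d G = Si + V * mat_adjoint V" unfolding frame_op_def GQ GQ' mat_adjoint_adjoint by (rule QQ)
  ultimately show ?thesis by blast
qed

text \<open>The perturbation is diagonal in an eigenbasis of the inverse frame operator. The bound
  on k says d - k <= n - d, so the raised entries fit into the columns available to V.\<close>

lemma exists_dual_frame_eigs:
  assumes F: "F \<in> frames n d" and "d \<le> n"
    and l: "l = eigs (the (mat_inverse (frame_op d F)))"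
    and \<nu>: "sorted_wrt (\<ge>) \<nu>" "mset \<nu> = mset (take k l @ map (max c) (drop k l))" and k: "2 * d \<le> n + k"
  shows "\<exists>G \<in> dual_frames n d F. eigs (frame_op d G) = \<nu>"
proof -
  define Si where "Si = the (mat_inverse (frame_op d F))"
  note Si = frame_op_inverse[OF F, folded Si_def]
  obtain U where Ul: "unitary_diag U l Si" "length l = d"
    using hermitian_eigs[OF Si(1,4)] unfolding l Si_def[symmetric] by blast
  define D where "D = mat_diag d (\<lambda>i. complex_of_real (l ! i))"
  have U: "U \<in> carrier_mat d d" and UU: "mat_adjoint U * U = 1\<^sub>m d" and SU: "Si = U * D * mat_adjoint U"
    using Ul by (auto simp: unitary_diag_def D_def)
  define \<kappa> where "\<kappa> = take k l @ map (max c) (drop k l)"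
  have len: "length \<kappa> = d" using Ul(2) by (simp add: \<kappa>_def)
  have \<kappa>: "\<kappa> ! i = (if i < k then l ! i else max c (l ! i))" if "i < d" for i
    using that Ul(2) by (simp add: \<kappa>_def nth_append min_def)
  define b where "b i = (if i < k then 0 else \<kappa> ! i - l ! i)" for i
  have b: "0 \<le> b i" "l ! i + b i = \<kappa> ! i" if "i < d" for i using \<kappa>[OF that] by (auto simp: b_def)
  define E where "E = mat_diag d (\<lambda>i. complex_of_real (b i))"
  have DE: "D \<in> carrier_mat d d" "E \<in> carrier_mat d d" by (auto simp: D_def E_def)
  have bk: "b i = 0" if "i < k" for i using that by (simp add: b_def)
  have dk: "d \<le> k + (n - d)" using k \<open>d \<le> n\<close> by linarith
  obtain V where V: "V \<in> carrier_mat d (n - d)" "V * mat_adjoint V = U * E * mat_adjoint U"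
    using exists_factorization[OF U, of b k, OF b(1) bk dk] unfolding E_def by blast
  obtain G where G: "G \<in> dual_frames n d F" "frame_op d G = Si + V * mat_adjoint V"
    using exists_dual_frame[OF F V(1) \<open>d \<le> n\<close>] by (auto simp: Si_def)
  have "frame_op d G = (U * D + U * E) * mat_adjoint U"
    using add_mult_distrib_mat[OF mult_carrier_mat[OF U DE(1)] mult_carrier_mat[OF U DE(2)] mat_adjoint_carrier[OF U]]
    by (simp add: G(2) V(2) SU)
  also have "U * D + U * E = U * (D + E)" by (rule mult_add_distrib_mat[OF U DE, symmetric])
  also have "D + E = mat_diag d (\<lambda>i. complex_of_real (\<kappa> ! i))"
    using b(2) by (intro eq_matI) (auto simp: D_def E_def mat_diag_def simp flip: of_real_add)
  finally have "unitary_diag U \<kappa> (frame_op d G)" using U UU by (simp add: unitary_diag_def len)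
  then have "eigs (frame_op d G) = \<nu>" using \<nu> by (intro eigs_eq) (auto simp: \<kappa>_def)
  then show ?thesis using G(1) by blast
qed

section \<open>Trace and potential through the spectrum, and the conclusion\<close>

lemma trace_frame_op: "Re (mat_tr (frame_op d G)) = (\<Sum>i<d. eigs (frame_op d G) ! i)"
  and convex_potential_eigs: "convex_potential d f G = (\<Sum>i<d. f (eigs (frame_op d G) ! i))"
proof -
  obtain U where U: "unitary_diag U (eigs (frame_op d G)) (frame_op d G)" "length (eigs (frame_op d G)) = d"
    by (rule hermitian_eigs[OF frame_op_hermitian])
  have UU: "U \<in> carrier_mat d d" "mat_adjoint U * U = 1\<^sub>m d"
    and S: "frame_op d G = U * mat_diag d (\<lambda>i. complex_of_real (eigs (frame_op d G) ! i)) * mat_adjoint U"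
    using U by (auto simp: unitary_diag_def)
  have "mat_tr (frame_op d G) = (\<Sum>i<d. complex_of_real (eigs (frame_op d G) ! i))"
    by (subst S) (rule mat_tr_unitary_conj[OF UU])
  then show "Re (mat_tr (frame_op d G)) = (\<Sum>i<d. eigs (frame_op d G) ! i)" by simp
  have "mat_tr (mat_fun f (frame_op d G)) = (\<Sum>i<d. complex_of_real (f (eigs (frame_op d G) ! i)))"
    unfolding mat_fun_unitary_diag[OF U(1)] U(2) by (rule mat_tr_unitary_conj[OF UU])
  then show "convex_potential d f G = (\<Sum>i<d. f (eigs (frame_op d G) ! i))"
    by (simp add: convex_potential_def)
qed

theorem theorem4p11:
  fixes n d :: nat and F :: "complex vec list" and t :: real
    and l \<nu> :: "real list" and m :: int
  assumes "1 \<le> d" and "d < n"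
    and "F \<in> frames n d"
    and "l = eigs (the (mat_inverse (frame_op d F)))"
    and "m = 2 * int d - int n"
    and "sum_list l \<le> t"
    and "\<nu> = nu_vec l m t"
  shows "\<nu> \<in> dual_spectra n d F t \<and>
    (\<forall>Gt \<in> dual_frames_ge n d F t. eigs (frame_op d Gt) = \<nu> \<longrightarrow>
       (\<forall>f. f \<in> {0..} \<rightarrow> {0..} \<and> mono_on {0..} f \<and> convex_on {0..} f \<longrightarrow>
          (\<Sum>i<d. f (\<nu> ! i)) = convex_potential d f Gt \<and>
          (\<forall>G \<in> dual_frames_ge n d F t. convex_potential d f Gt \<le> convex_potential d f G))) \<and>
    (\<forall>f. f \<in> {0..} \<rightarrow> {0..} \<and> mono_on {0..} f \<and> convex_on {0..} f \<and>
         strictly_convex_on {0..} f \<longrightarrow>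
       (\<forall>Gt' \<in> dual_frames_ge n d F t.
          (\<forall>G \<in> dual_frames_ge n d F t. convex_potential d f Gt' \<le> convex_potential d f G) \<longrightarrow>
          eigs (frame_op d Gt') = \<nu>))"
proof -
  note F = assms(3) and l = assms(4)
  define Si where "Si = the (mat_inverse (frame_op d F))"
  define k where "k = nat m"
  have dn: "d \<le> n" and k: "2 * d \<le> n + k" and md: "m < int d"
    using assms(1,2,5) by (auto simp: k_def)
  note Si = frame_op_inverse[OF F, folded Si_def]
  obtain U where U: "unitary_diag U l Si" "sorted_wrt (\<ge>) l" "length l = d"
    using hermitian_eigs[OF Si(1,4)] unfolding l Si_def[symmetric] by blast
  \<comment> \<open>Any dual frame will do: positivity of \<open>Si\<close> is obtained from
    \<open>dual_frame_quadratic\<close>, which is stated relative to one.\<close>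
  obtain G0 where G0: "G0 \<in> dual_frames n d F"
    using exists_dual_frame[OF F _ dn] zero_carrier_mat by blast
  have l_nonneg: "0 \<le> l ! i" if "i < d" for i
    using unitary_diag_nonneg[OF U(1,3) that] dual_frame_quadratic(3)[OF F G0] by (simp add: Si_def)
  then have "0 \<le> x" if "x \<in> set l" for x using that U(3) by (auto simp: in_set_conv_nth)
  from nu_vec_props[OF U(2) U(3)[symmetric] md _ this assms(6) k_def] assms(1)
  obtain c where c: "0 \<le> c" and len: "length \<nu> = d" and sorted: "sorted_wrt (\<ge>) \<nu>"
    and sum: "sum_list \<nu> = t" and mset: "mset \<nu> = mset (take k l @ map (max c) (drop k l))"
    and seg: "\<And>\<mu> i. (\<And>j. j < d \<Longrightarrow> l ! j \<le> \<mu> j) \<Longrightarrow>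
      (\<And>j. d - k \<le> j \<Longrightarrow> j < d \<Longrightarrow> \<mu> j \<le> l ! (j - (d - k))) \<Longrightarrow> i < d \<Longrightarrow> (c \<le> \<nu> ! i \<and> \<nu> ! i \<le> \<mu> i) \<or> (\<mu> i \<le> \<nu> ! i \<and> \<nu> ! i \<le> c)"
    unfolding assms(7)[symmetric] by (metis One_nat_def Suc_le_eq)
  have sum': "(\<Sum>i<d. \<nu> ! i) = t" using sum len by (simp add: sum_list_sum_nth atLeast0LessThan)
  have \<mu>: "(c \<le> \<nu> ! i \<and> \<nu> ! i \<le> eigs (frame_op d G) ! i) \<or> (eigs (frame_op d G) ! i \<le> \<nu> ! i \<and> \<nu> ! i \<le> c)" "0 \<le> eigs (frame_op d G) ! i"
    if G: "G \<in> dual_frames n d F" and i: "i < d" for G i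
  proof -
    note lo = dual_frame_eigs(1)[OF F G dn, folded l] and hi = dual_frame_eigs(2)[OF F G dn, folded l]
    show "0 \<le> eigs (frame_op d G) ! i" using lo[OF i] l_nonneg[OF i] by simp
    have "eigs (frame_op d G) ! j \<le> l ! (j - (d - k))" if j: "d - k \<le> j" "j < d" for j
    proof -
      \<comment> \<open>For m <= 0 the truncation gives k = 0 and no such j exists. For m > 0 the
        shift d - k of \<open>nu_vec_props\<close> is the shift n - d of the interlacing
        bound.\<close>
      have "0 < k" using j by (cases "k = 0") auto
      then have "d - k = n - d" using assms(5) k_def by auto
      then show ?thesis using hi[OF j(2)] j(1) by simp
    qed
    then show "(c \<le> \<nu> ! i \<and> \<nu> ! i \<le> eigs (frame_op d G) ! i) \<or> (eigs (frame_op d G) ! i \<le> \<nu> ! i \<and> \<nu> ! i \<le> c)"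
      using seg[of "\<lambda>i. eigs (frame_op d G) ! i"] lo i by blast
  qed
  have tr: "(\<Sum>i<d. \<nu> ! i) \<le> (\<Sum>i<d. eigs (frame_op d G) ! i)" if "G \<in> dual_frames_ge n d F t" for G
    using that sum' by (simp add: dual_frames_ge_def trace_frame_op)
  have dual: "G \<in> dual_frames n d F" if "G \<in> dual_frames_ge n d F t" for G
    using that by (simp add: dual_frames_ge_def)
  obtain G1 where G1: "G1 \<in> dual_frames n d F" "eigs (frame_op d G1) = \<nu>"
    using exists_dual_frame_eigs[OF F dn l sorted mset k] by blast
  then have G1': "G1 \<in> dual_frames_ge n d F t" by (simp add: dual_frames_ge_def trace_frame_op sum')
  have "\<nu> \<in> dual_spectra n d F t" using G1 G1' by (auto simp: dual_spectra_def)
  moreover have "convex_potential d f Gt \<le> convex_potential d f G"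
    if "eigs (frame_op d Gt) = \<nu>" "mono_on {0..} f" "convex_on {0..} f" "G \<in> dual_frames_ge n d F t" for f Gt G
    unfolding convex_potential_eigs that(1)
    using sum_convex_le(1)[OF that(2,3) c \<mu>[OF dual[OF that(4)]] tr[OF that(4)]] .
  moreover have "eigs (frame_op d Gt) = \<nu>"
    if Gt: "Gt \<in> dual_frames_ge n d F t" and f: "mono_on {0..} f" "convex_on {0..} f" "strictly_convex_on {0..} f"
      and min: "\<forall>G \<in> dual_frames_ge n d F t. convex_potential d f Gt \<le> convex_potential d f G" for f Gt
  proof (rule nth_equalityI)
    show "length (eigs (frame_op d Gt)) = length \<nu>"
      using hermitian_eigs[OF frame_op_hermitian] len by metis
    fix i assume "i < length (eigs (frame_op d Gt))"
    then have i: "i < d" using hermitian_eigs[OF frame_op_hermitian] by metis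
    \<comment> \<open>G1 has spectrum \<nu>, so minimality supplies the reverse inequality that the
      equality case of \<open>sum_convex_le\<close> asks for.\<close>
    have "convex_potential d f Gt \<le> convex_potential d f G1" using min G1' by blast
    then show "eigs (frame_op d Gt) ! i = \<nu> ! i"
      using sum_convex_le(2)[OF f(1,2) c \<mu>[OF dual[OF Gt]] tr[OF Gt] f(3) _ i]
      by (simp add: convex_potential_eigs G1(2))
  qed
  ultimately show ?thesis by (auto simp: convex_potential_eigs)
qed

end
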